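(* Let $K=(0,1)^2$ be the unit square with edges parallel to the axes, $M=P_k(\partial K)^2$, $\Sigma_g=Q_k(K;\mathbb S)$, $V_g=Q_k(K)^2$, where $k\ge2$. Define $$\delta\Sigma_{\mathrm{fillM}}=\begin{cases}J\,\mathrm{span}\{B_2,B_3,B_4,B_4x,(xy)^2(1-x),(xy)^2(1-y),\\ \qquad(xy)^2(1-x)(1-y),(xe^{1-y}y)^2(1-x)^2,(e^{1-x}xy)^2(1-y)^2\}&k=2,\\[2pt] J\,\mathrm{span}\{B_2,B_3,B_4,B_4x,(xy)^2(1-x)^{k-1},(xy)^2(1-y)^{k-1},\\ \qquad(xy)^2(1-x)^{k-1}(1-y),(xy)^2(1-x)(1-y)^{k-1},\\ \qquad(xe^{1-y}y)^2(1-x)^k,(e^{1-x}xy)^2(1-y)^k\}&k\ge3,\end{cases}$$ where $B_i=\prod_{m=1}^4\lambda_m\prod_{j\ne i}\frac{\lambda_j}{\lambda_j+\lambda_i}$. Then $\nabla\cdot\delta\Sigma_{\mathrm{fillM}}=\{0\}$, $\gamma\,\delta\Sigma_{\mathrm{fillM}}\subset M$, $\gamma\,\delta\Sigma_{\mathrm{fillM}}\cap\gamma\Sigma_{g,s}=\{0\}$, and $\dim\delta\Sigma_{\mathrm{fillM}}=\dim\gamma\,\delta\Sigma_{\mathrm{fillM}}=I_M(\Sigma_g\times V_g)$.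
   Context: $\mathbb S$: symmetric $2\times2$ real matrices. $P_k(\partial K)^2$: vector functions on $\partial K$ whose restriction to each edge is polynomial of degree $\le k$ (no continuity at vertices). $Q_k$: polynomials of degree $\le k$ in each variable. $\lambda_1=x,\lambda_2=y,\lambda_3=1-x,\lambda_4=1-y$. Airy stress operator: $J\phi=\begin{pmatrix}\partial_{yy}\phi&-\partial_{xy}\phi\\-\partial_{xy}\phi&\partial_{xx}\phi\end{pmatrix}$; $J\,\mathrm{span}\{\dots\}$ is the image of the span. $\gamma S=\{\tau n|_{\partial K}:\tau\in S\}$ with $n$ the outward unit normal, $\nabla\cdot$ is the row-wise divergence, $\epsilon(v)=\frac12(\nabla v+\nabla v^T)$, $\Sigma_{g,s}=\{\tau\in\Sigma_g:\nabla\cdot\tau=0\}$. $I_M(\Sigma\times V)=\dim M-\dim\{\tau n|_{\partial K}:\tau\in\Sigma,\nabla\cdot\tau=0\}-\dim\{v|_{\partial K}:v\in V,\epsilon(v)=0\}$. *)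

theory Defs
  imports
    "HOL-Analysis.Analysis"
    "HOL-Library.Function_Algebras"
    "HOL-Computational_Algebra.Polynomial"
begin

text \<open>
  Function spaces are subsets of function types with the pointwise vector space structure, so that
  \<^const>\<open>span\<close> and \<^const>\<open>dim\<close> apply to them.
\<close>

instantiation "fun" :: (type, real_vector) real_vector
begin

definition scaleR_fun :: "real \<Rightarrow> ('a \<Rightarrow> 'b) \<Rightarrow> 'a \<Rightarrow> 'b"
  where "scaleR_fun c f = (\<lambda>x. c *\<^sub>R f x)"

instance
  by standard (simp_all add: scaleR_fun_def plus_fun_def scaleR_add_right scaleR_add_left)

end

definition K :: "(real^2) set"
  where "K = box 0 1"

definition lam :: "nat \<Rightarrow> real^2 \<Rightarrow> real"
  where "lam i z = (if i = 1 then z$1 else if i = 2 then z$2 else if i = 3 then 1 - z$1 else 1 - z$2)"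

text \<open>
  Edges are taken without their end points. Functions on the boundary live on the union of the four
  open edges: the spaces involved carry no values at the vertices (no continuity is imposed there,
  and stresses may be singular there).
\<close>

definition edge :: "nat \<Rightarrow> (real^2) set"
  where "edge i = {z \<in> frontier K. lam i z = 0 \<and> (\<forall>j\<in>{1..4} - {i}. lam j z \<noteq> 0)}"

definition skeleton :: "(real^2) set"
  where "skeleton = (\<Union>i\<in>{1..4}. edge i)"

definition outward_normal :: "real^2 \<Rightarrow> real^2"
  where "outward_normal z =
    (if z \<in> edge 1 then - axis 1 1
     else if z \<in> edge 2 then - axis 2 1
     else if z \<in> edge 3 then axis 1 1
     else if z \<in> edge 4 then axis 2 1
     else 0)"

text \<open>
  A function on the open square is represented by its extension by zero, and likewise a function on
  the boundary. This makes equality of functions (hence linear independence and dimension) mean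
  equality on the square, respectively on the open edges.
\<close>

definition on_K :: "(real^2 \<Rightarrow> 'b::real_vector) \<Rightarrow> real^2 \<Rightarrow> 'b"
  where "on_K f = (\<lambda>z. if z \<in> K then f z else 0)"

definition pd :: "2 \<Rightarrow> (real^2 \<Rightarrow> real) \<Rightarrow> real^2 \<Rightarrow> real"
  where "pd i f z = deriv (\<lambda>t. f (z + t *\<^sub>R axis i 1)) 0"

definition airy :: "(real^2 \<Rightarrow> real) \<Rightarrow> real^2 \<Rightarrow> real^2^2"
  where "airy \<phi> = on_K (\<lambda>z. vector
    [vector [pd 2 (pd 2 \<phi>) z, - pd 1 (pd 2 \<phi>) z],
     vector [- pd 1 (pd 2 \<phi>) z, pd 1 (pd 1 \<phi>) z]])"

definition rowdiv :: "(real^2 \<Rightarrow> real^2^2) \<Rightarrow> real^2 \<Rightarrow> real^2"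
  where "rowdiv \<tau> = on_K (\<lambda>z. \<chi> i. \<Sum>j\<in>UNIV. pd j (\<lambda>w. \<tau> w $ i $ j) z)"

definition symgrad :: "(real^2 \<Rightarrow> real^2) \<Rightarrow> real^2 \<Rightarrow> real^2^2"
  where "symgrad v = on_K (\<lambda>z. \<chi> i j. (pd j (\<lambda>w. v w $ i) z + pd i (\<lambda>w. v w $ j) z) / 2)"

text \<open>Boundary values are limits from inside the square, at points of the open edges.\<close>

definition trace_bd :: "(real^2 \<Rightarrow> 'b::{real_vector, t2_space}) \<Rightarrow> real^2 \<Rightarrow> 'b"
  where "trace_bd f = (\<lambda>z. if z \<in> skeleton then Lim (at z within K) f else 0)"

definition normal_trace :: "(real^2 \<Rightarrow> real^2^2) \<Rightarrow> real^2 \<Rightarrow> real^2"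
  where "normal_trace \<tau> = (\<lambda>z. trace_bd \<tau> z *v outward_normal z)"

text \<open>On an edge, degree is measured in the arc length parameter, i.e. the coordinate along the edge.\<close>

definition P_bd :: "nat \<Rightarrow> (real^2 \<Rightarrow> real^2) set"
  where "P_bd k = {g. (\<forall>z. z \<notin> skeleton \<longrightarrow> g z = 0) \<and>
    (\<forall>i\<in>{1..4}. \<forall>m. \<exists>p :: real poly. degree p \<le> k \<and>
      (\<forall>z\<in>edge i. g z $ m = poly p (if odd i then z$2 else z$1)))}"

definition Q :: "nat \<Rightarrow> (real^2 \<Rightarrow> real) set"
  where "Q k = {on_K (\<lambda>z. \<Sum>i\<le>k. \<Sum>j\<le>k. c i j * (z$1)^i * (z$2)^j) | c. True}"

definition Q_vec :: "nat \<Rightarrow> (real^2 \<Rightarrow> real^2) set"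
  where "Q_vec k = {v. \<forall>i. (\<lambda>z. v z $ i) \<in> Q k}"

definition Q_sym :: "nat \<Rightarrow> (real^2 \<Rightarrow> real^2^2) set"
  where "Q_sym k = {\<tau>. (\<forall>z. transpose (\<tau> z) = \<tau> z) \<and> (\<forall>i j. (\<lambda>z. \<tau> z $ i $ j) \<in> Q k)}"

definition solenoidal :: "(real^2 \<Rightarrow> real^2^2) set \<Rightarrow> (real^2 \<Rightarrow> real^2^2) set"
  where "solenoidal \<Sigma> = {\<tau> \<in> \<Sigma>. rowdiv \<tau> = 0}"

definition I_M :: "(real^2 \<Rightarrow> real^2) set \<Rightarrow> (real^2 \<Rightarrow> real^2^2) set \<Rightarrow> (real^2 \<Rightarrow> real^2) set \<Rightarrow> int"
  where "I_M M \<Sigma> V =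
    int (dim M) - int (dim (normal_trace ` solenoidal \<Sigma>))
      - int (dim (trace_bd ` {v \<in> V. symgrad v = 0}))"

definition B :: "nat \<Rightarrow> real^2 \<Rightarrow> real"
  where "B i z = (\<Prod>m\<in>{1..4}. lam m z) * (\<Prod>j\<in>{1..4} - {i}. lam j z / (lam j z + lam i z))"

definition fill_generators :: "nat \<Rightarrow> (real^2 \<Rightarrow> real) set"
  where "fill_generators k =
    (if k = 2 then
      {B 2, B 3, B 4, \<lambda>z. B 4 z * z$1,
       \<lambda>z. (z$1 * z$2)^2 * (1 - z$1),
       \<lambda>z. (z$1 * z$2)^2 * (1 - z$2),
       \<lambda>z. (z$1 * z$2)^2 * (1 - z$1) * (1 - z$2),
       \<lambda>z. (z$1 * exp (1 - z$2) * z$2)^2 * (1 - z$1)^2,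
       \<lambda>z. (exp (1 - z$1) * z$1 * z$2)^2 * (1 - z$2)^2}
     else
      {B 2, B 3, B 4, \<lambda>z. B 4 z * z$1,
       \<lambda>z. (z$1 * z$2)^2 * (1 - z$1)^(k - 1),
       \<lambda>z. (z$1 * z$2)^2 * (1 - z$2)^(k - 1),
       \<lambda>z. (z$1 * z$2)^2 * (1 - z$1)^(k - 1) * (1 - z$2),
       \<lambda>z. (z$1 * z$2)^2 * (1 - z$1) * (1 - z$2)^(k - 1),
       \<lambda>z. (z$1 * exp (1 - z$2) * z$2)^2 * (1 - z$1)^k,
       \<lambda>z. (exp (1 - z$1) * z$1 * z$2)^2 * (1 - z$2)^k})"

definition fillM :: "nat \<Rightarrow> (real^2 \<Rightarrow> real^2^2) set"
  where "fillM k = airy ` span (fill_generators k)"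

end

theory Submission
  imports Defs
begin

text \<open>
  All potentials involved are smooth on the open diamond \<open>|x - 1/2| + |y - 1/2| < 1\<close>, which contains the
  square and its open edges, and on each edge both the potential and its normal derivative are
  polynomials. The normal trace of the Airy stress on an edge consists, up to sign, of the second
  derivative of the former and the first derivative of the latter, so it vanishes iff the potential is
  affine and its normal derivative constant on that edge.

  The potentials of divergence-free stresses in \<open>Q\<^sub>k\<close> are spanned modulo affine functions and
  interior bubbles by the monomials \<open>x\<^sup>i y\<^sup>j\<close> with \<open>i \<le> 1\<close> or \<open>j \<le> 1\<close> and by the functions
  \<open>h\<^sub>i\<^sub>j = x\<^sup>2 y\<^sup>2 (1-x)\<^sup>i (1-y)\<^sup>j\<close> with \<open>i, j \<le> k - 2\<close>, \<open>i \<le> 1\<close> or \<open>j \<le> 1\<close>. The polynomial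
  generators of the filling space are exactly the remaining \<open>h\<^sub>i\<^sub>j\<close> with \<open>i, j \<le> k - 1\<close>, \<open>i \<le> 1\<close> or
  \<open>j \<le> 1\<close>, both for \<open>k = 2\<close> (where two of the four listed for \<open>k \<ge> 3\<close> coincide) and for \<open>k \<ge> 3\<close>.
  Together this gives \<open>8 k + 5\<close> potentials, and reading off
  the edge data in the order \<open>x = 0\<close>, \<open>y = 0\<close>, \<open>x = 1\<close>, \<open>y = 1\<close> shows that their traces are linearly
  independent. Since \<open>8 (k + 1) - 3 = 8 k + 5\<close>, all dimension claims follow.
\<close>

subsection \<open>Linearly independent families\<close>

text \<open>Independence is stated for an indexed family, not for a set: over a finite index set it
  then also forces the members to be distinct, and dimensions become cardinalities of index
  sets.\<close>

definition lin_indep :: "('i \<Rightarrow> 'v::real_vector) \<Rightarrow> 'i set \<Rightarrow> bool"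
  where "lin_indep g I \<longleftrightarrow> (\<forall>c. (\<Sum>i\<in>I. c i *\<^sub>R g i) = 0 \<longrightarrow> (\<forall>i\<in>I. c i = 0))"

lemma lin_indepD: "lin_indep g I \<Longrightarrow> (\<Sum>i\<in>I. c i *\<^sub>R g i) = 0 \<Longrightarrow> i \<in> I \<Longrightarrow> c i = 0"
  unfolding lin_indep_def by blast

lemma lin_indep_subset:
  assumes "lin_indep g I" "J \<subseteq> I" "finite I"
  shows "lin_indep g J"
  unfolding lin_indep_def
proof (intro allI impI ballI)
  fix c i assume z: "(\<Sum>i\<in>J. c i *\<^sub>R g i) = 0" and i: "i \<in> J"
  have "(\<Sum>i\<in>I. (if i \<in> J then c i else 0) *\<^sub>R g i) = (\<Sum>i\<in>J. c i *\<^sub>R g i)"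
    by (rule sum.mono_neutral_cong_right) (use assms in auto)
  then have "(if i \<in> J then c i else 0) = 0"
    using lin_indepD[OF assms(1), of "\<lambda>i. if i \<in> J then c i else 0" i] z i assms(2) by auto
  then show "c i = 0" using i by simp
qed

lemma lin_indep_inj_on:
  assumes "lin_indep g I" "finite I"
  shows "inj_on g I"
proof (rule inj_onI, rule ccontr)
  fix i j assume ij: "i \<in> I" "j \<in> I" "g i = g j" "i \<noteq> j"
  have "lin_indep g {i, j}" using lin_indep_subset[OF assms(1), of "{i,j}"] ij assms(2) by auto
  from lin_indepD[OF this, of "\<lambda>x. if x = i then 1 else -1" i] ij show False by auto
qed

lemma dim_lin_indep:
  assumes "lin_indep g I" "finite I"
  shows "dim (g ` I) = card I"
proof -
  have inj: "inj_on g I" by (rule lin_indep_inj_on[OF assms])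
  have "independent (g ` I)"
  proof (rule independent_if_scalars_zero)
    fix f x assume "(\<Sum>x\<in>g ` I. f x *\<^sub>R x) = 0" "x \<in> g ` I"
    then show "f x = 0" using lin_indepD[OF assms(1), of "f \<circ> g"] by (auto simp: sum.reindex[OF inj])
  qed (use assms in auto)
  then show ?thesis by (simp add: dim_eq_card_independent card_image[OF inj])
qed

lemma span_family:
  assumes "finite I"
  shows "span (g ` I) = range (\<lambda>c. \<Sum>i\<in>I. c i *\<^sub>R g i)"
proof
  have "subspace (range (\<lambda>c. \<Sum>i\<in>I. c i *\<^sub>R g i))"
    unfolding subspace_def
  proof (intro conjI ballI allI)
    show "0 \<in> range (\<lambda>c. \<Sum>i\<in>I. c i *\<^sub>R g i)" by (rule range_eqI[of _ _ "\<lambda>_. 0"]) simp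
    fix x y r
    assume "x \<in> range (\<lambda>c. \<Sum>i\<in>I. c i *\<^sub>R g i)"
    then obtain a where x: "x = (\<Sum>i\<in>I. a i *\<^sub>R g i)" by auto
    show "r *\<^sub>R x \<in> range (\<lambda>c. \<Sum>i\<in>I. c i *\<^sub>R g i)"
      by (rule range_eqI[of _ _ "\<lambda>i. r * a i"]) (simp add: x scaleR_sum_right)
    assume "y \<in> range (\<lambda>c. \<Sum>i\<in>I. c i *\<^sub>R g i)"
    then obtain b where y: "y = (\<Sum>i\<in>I. b i *\<^sub>R g i)" by auto
    show "x + y \<in> range (\<lambda>c. \<Sum>i\<in>I. c i *\<^sub>R g i)"
      by (rule range_eqI[of _ _ "\<lambda>i. a i + b i"]) (simp add: x y scaleR_add_left sum.distrib)
  qed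
  moreover have "g j \<in> range (\<lambda>c. \<Sum>i\<in>I. c i *\<^sub>R g i)" if "j \<in> I" for j
    by (rule range_eqI[of _ _ "\<lambda>i. if i = j then 1 else 0"])
      (use that assms in \<open>simp add: if_distrib[of "\<lambda>a. a *\<^sub>R _"] cong: if_cong\<close>)
  ultimately show "span (g ` I) \<subseteq> range (\<lambda>c. \<Sum>i\<in>I. c i *\<^sub>R g i)"
    by (intro span_minimal) auto
  have "(\<Sum>i\<in>I. c i *\<^sub>R g i) \<in> span (g ` I)" for c
    by (intro span_sum span_scale span_base) auto
  then show "range (\<lambda>c. \<Sum>i\<in>I. c i *\<^sub>R g i) \<subseteq> span (g ` I)" by auto
qed

lemma lin_indep_span_disjoint:
  assumes "lin_indep g (I \<union> J)" "finite I" "finite J" "I \<inter> J = {}"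
  shows "span (g ` I) \<inter> span (g ` J) = {0}"
proof -
  have "x = 0" if "x \<in> span (g ` I)" "x \<in> span (g ` J)" for x
  proof -
    have "x \<in> range (\<lambda>c. \<Sum>i\<in>I. c i *\<^sub>R g i)"
      using that(1) by (simp only: span_family[OF assms(2)])
    then obtain a where a: "x = (\<Sum>i\<in>I. a i *\<^sub>R g i)" ..
    have "x \<in> range (\<lambda>c. \<Sum>i\<in>J. c i *\<^sub>R g i)"
      using that(2) by (simp only: span_family[OF assms(3)])
    then obtain b where b: "x = (\<Sum>i\<in>J. b i *\<^sub>R g i)" ..
    \<comment> \<open>Subtracting the two representations of \<open>x\<close> turns them into one
      relation over the joint family.\<close>
    let ?c = "\<lambda>i. if i \<in> I then a i else - b i"
    have "(\<Sum>i\<in>I \<union> J. ?c i *\<^sub>R g i) = (\<Sum>i\<in>I. ?c i *\<^sub>R g i) + (\<Sum>i\<in>J. ?c i *\<^sub>R g i)"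
      using assms by (intro sum.union_disjoint) auto
    also have "(\<Sum>i\<in>I. ?c i *\<^sub>R g i) = x" unfolding a by (intro sum.cong) auto
    also have "(\<Sum>i\<in>J. ?c i *\<^sub>R g i) = - x"
      unfolding b sum_negf[symmetric] using assms by (intro sum.cong) auto
    finally have "?c i = 0" if "i \<in> I \<union> J" for i
      using lin_indepD[OF assms(1), of ?c i] that by simp
    then have "a i = 0" if "i \<in> I" for i using that by (metis UnI1)
    then show "x = 0" unfolding a by (intro sum.neutral) auto
  qed
  then show ?thesis by (auto simp: span_zero)
qed

text \<open>\<open>pd\<close>, \<open>airy\<close> and the traces are total operators whose
  linearity is guaranteed only where derivatives exist. It is therefore assumed on a subspace
  containing the generators, in the applications that of the smooth functions.\<close>

lemma image_span_linear_on:
  fixes f :: "'a::real_vector \<Rightarrow> 'b::real_vector"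
  assumes S: "subspace S" "A \<subseteq> S"
    and add: "\<And>x y. x \<in> S \<Longrightarrow> y \<in> S \<Longrightarrow> f (x + y) = f x + f y"
    and scale: "\<And>c x. x \<in> S \<Longrightarrow> f (c *\<^sub>R x) = c *\<^sub>R f x"
  shows "f ` span A = span (f ` A)"
proof
  have f0: "f 0 = 0" using scale[of 0 0] S(1) by (simp add: subspace_0)
  have sub: "span A \<subseteq> S" using S by (rule span_minimal[rotated])
  show "f ` span A \<subseteq> span (f ` A)"
  proof clarify
    fix x assume "x \<in> span A"
    then have "x \<in> S \<and> f x \<in> span (f ` A)"
    proof (induction rule: span_induct_alt)
      case base show ?case using f0 S(1) by (simp add: subspace_0 span_zero)
    next
      case (step c x y)
      then have "x \<in> S" "c *\<^sub>R x \<in> S" using S by (auto simp: subspace_scale)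
      then show ?case using step S
        by (auto simp: add scale subspace_add intro!: span_add span_scale intro: span_base)
    qed
    then show "f x \<in> span (f ` A)" ..
  qed
  have "subspace (f ` span A)"
    unfolding subspace_def
  proof (intro conjI ballI allI)
    show "0 \<in> f ` span A" by (rule image_eqI[of _ _ 0]) (simp_all add: f0 span_zero)
    fix x y r
    assume "x \<in> f ` span A"
    then obtain a where a: "x = f a" "a \<in> span A" by auto
    show "r *\<^sub>R x \<in> f ` span A"
      by (rule image_eqI[of _ _ "r *\<^sub>R a"]) (use a sub in \<open>auto simp: scale span_scale\<close>)
    assume "y \<in> f ` span A"
    then obtain b where b: "y = f b" "b \<in> span A" by auto
    show "x + y \<in> f ` span A"
      by (rule image_eqI[of _ _ "a + b"]) (use a b sub add[of a b] in \<open>auto simp: span_add subsetD\<close>)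
  qed
  then show "span (f ` A) \<subseteq> f ` span A"
    by (intro span_minimal) (auto intro: span_base)
qed

lemma sum_linear_on:
  fixes f :: "'a::real_vector \<Rightarrow> 'b::real_vector"
  assumes S: "subspace S" "\<And>i. i \<in> I \<Longrightarrow> g i \<in> S"
    and add: "\<And>x y. x \<in> S \<Longrightarrow> y \<in> S \<Longrightarrow> f (x + y) = f x + f y"
    and scale: "\<And>c x. x \<in> S \<Longrightarrow> f (c *\<^sub>R x) = c *\<^sub>R f x"
  shows "f (\<Sum>i\<in>I. c i *\<^sub>R g i) = (\<Sum>i\<in>I. c i *\<^sub>R f (g i))"
  using S(2)
proof (induction I rule: infinite_finite_induct)
  case (insert i I)
  then have "c i *\<^sub>R g i \<in> S" "(\<Sum>i\<in>I. c i *\<^sub>R g i) \<in> S"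
    using S(1) by (auto intro: subspace_scale subspace_sum)
  then show ?case using insert by (simp add: add scale)
qed (use scale[of 0 0] S(1) in \<open>simp_all add: subspace_0\<close>)

lemma sum_fun_apply: "(\<Sum>i\<in>I. f i) x = (\<Sum>i\<in>I. f i x)"
  by (induction I rule: infinite_finite_induct) (simp_all add: plus_fun_def zero_fun_def)

lemma scaleR_fun_apply: "(c *\<^sub>R f) x = c *\<^sub>R f x"
  by (simp add: scaleR_fun_def)

subsection \<open>Smooth functions and the Airy operator\<close>

text \<open>The inequalities say \<open>lam i z + lam j z > 0\<close> for adjacent edges; for
  opposite edges the sum is 1. Hence no denominator of \<open>B\<close> vanishes here, while each
  corner of the square makes one of these sums zero and stays outside.\<close>

definition diamond :: "(real^2) set"
  where "diamond = {z. z$1 + z$2 > 0 \<and> 1 - z$1 + z$2 > 0 \<and> z$1 + (1 - z$2) > 0 \<and> (1 - z$1) + (1 - z$2) > 0}"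

lemma open_diamond: "open diamond"
  unfolding diamond_def
  by (intro open_Collect_conj open_Collect_less continuous_intros)

lemma mem_K: "z \<in> K \<longleftrightarrow> 0 < z$1 \<and> z$1 < 1 \<and> 0 < z$2 \<and> z$2 < 1"
  by (auto simp: K_def mem_box_cart forall_2)

lemma open_K: "open K" by (simp add: K_def open_box)

lemma K_subset_diamond: "K \<subseteq> diamond" by (auto simp: mem_K diamond_def)

text \<open>\<open>pd\<close> takes its value from \<open>deriv\<close> even without
  differentiability; this relation asserts existence of the derivative as well, and \<open>g\<close>
  matters only on the diamond.\<close>

definition has_pd :: "2 \<Rightarrow> (real^2 \<Rightarrow> real) \<Rightarrow> (real^2 \<Rightarrow> real) \<Rightarrow> bool"
  where "has_pd i f g \<longleftrightarrow> (\<forall>z\<in>diamond. ((\<lambda>t. f (z + t *\<^sub>R axis i 1)) has_real_derivative g z) (at 0))"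

lemma has_pdI: "(\<And>z. z \<in> diamond \<Longrightarrow> ((\<lambda>t. f (z + t *\<^sub>R axis i 1)) has_real_derivative g z) (at 0)) \<Longrightarrow> has_pd i f g"
  by (simp add: has_pd_def)

lemma has_pdD: "has_pd i f g \<Longrightarrow> z \<in> diamond \<Longrightarrow> ((\<lambda>t. f (z + t *\<^sub>R axis i 1)) has_real_derivative g z) (at 0)"
  by (simp add: has_pd_def)

lemma has_pd_pd: "has_pd i f g \<Longrightarrow> z \<in> diamond \<Longrightarrow> pd i f z = g z"
  unfolding has_pd_def pd_def by (blast intro: DERIV_imp_deriv)

lemma eventually_line_in:
  fixes z :: "real^2"
  assumes "open U" "z \<in> U"
  shows "eventually (\<lambda>t::real. z + t *\<^sub>R axis i 1 \<in> U) (nhds 0)"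
proof -
  have "((\<lambda>t::real. z + t *\<^sub>R axis i 1) \<longlongrightarrow> z + 0 *\<^sub>R axis i 1) (nhds 0)"
    by (intro tendsto_intros filterlim_ident)
  then show ?thesis using assms by (auto elim: topological_tendstoD)
qed

lemma has_derivative_line_cong:
  fixes z :: "real^2"
  assumes "open U" "z \<in> U" "\<And>w. w \<in> U \<Longrightarrow> f w = g w"
  shows "((\<lambda>t. f (z + t *\<^sub>R axis i 1)) has_real_derivative d) (at 0) \<longleftrightarrow>
    ((\<lambda>t. g (z + t *\<^sub>R axis i 1)) has_real_derivative d) (at 0)"
  by (rule DERIV_cong_ev[OF refl _ refl], rule eventually_mono[OF eventually_line_in[OF assms(1,2)]], rule assms(3))

text \<open>Differentiation is local. With \<open>U\<close> the open square, a function extended by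
  zero can be replaced by its formula inside.\<close>

lemma pd_cong:
  assumes "open U" "z \<in> U" "\<And>w. w \<in> U \<Longrightarrow> f w = g w"
  shows "pd i f z = pd i g z"
  unfolding pd_def deriv_def using has_derivative_line_cong[where f=f and g=g, OF assms] by simp

lemma has_pd_cong:
  assumes "has_pd i f g" "\<And>z. z \<in> diamond \<Longrightarrow> f z = f' z" "\<And>z. z \<in> diamond \<Longrightarrow> g z = g' z"
  shows "has_pd i f' g'"
proof (rule has_pdI)
  fix z assume z: "z \<in> diamond"
  show "((\<lambda>t. f' (z + t *\<^sub>R axis i 1)) has_real_derivative g' z) (at 0)"
    using has_derivative_line_cong[where f=f and g=f', OF open_diamond z assms(2), where i=i] has_pdD[OF assms(1) z] assms(3)[OF z]
    by simp
qed

lemma has_pd_const: "has_pd i (\<lambda>z. c) (\<lambda>z. 0)"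
  by (rule has_pdI) simp

lemma has_pd_coord: "has_pd i (\<lambda>z. z$j) (\<lambda>z. if i = j then 1 else 0)"
  by (rule has_pdI) (auto simp: axis_def intro!: derivative_eq_intros)

lemma has_pd_add: "has_pd i f f' \<Longrightarrow> has_pd i g g' \<Longrightarrow> has_pd i (\<lambda>z. f z + g z) (\<lambda>z. f' z + g' z)"
  by (rule has_pdI) (auto dest!: has_pdD intro: DERIV_add)

lemma has_pd_mult: "has_pd i f f' \<Longrightarrow> has_pd i g g' \<Longrightarrow> has_pd i (\<lambda>z. f z * g z) (\<lambda>z. f' z * g z + f z * g' z)"
  by (rule has_pdI) (auto dest!: has_pdD intro!: derivative_eq_intros)

lemma has_pd_exp: "has_pd i f f' \<Longrightarrow> has_pd i (\<lambda>z. exp (f z)) (\<lambda>z. exp (f z) * f' z)"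
  by (rule has_pdI) (auto dest!: has_pdD intro!: derivative_eq_intros)

text \<open>The derivative is composed of constants, products and inverses, so that it falls again
  under the closure rules of \<open>smooth\<close>.\<close>

lemma has_pd_inverse:
  "has_pd i f f' \<Longrightarrow> (\<And>z. z \<in> diamond \<Longrightarrow> f z \<noteq> 0) \<Longrightarrow>
    has_pd i (\<lambda>z. inverse (f z)) (\<lambda>z. (-1) * (inverse (f z) * inverse (f z)) * f' z)"
  by (rule has_pdI) (auto dest!: has_pdD intro!: derivative_eq_intros)

text \<open>A class of expressions closed under partial differentiation and large enough for all
  potentials. Differentiability of every order follows by structural induction;
  \<open>smooth_cong\<close> makes membership depend only on the values on the diamond.\<close>

inductive smooth :: "(real^2 \<Rightarrow> real) \<Rightarrow> bool" where
  smooth_const: "smooth (\<lambda>z. c)"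
| smooth_coord: "smooth (\<lambda>z. z$i)"
| smooth_add: "smooth f \<Longrightarrow> smooth g \<Longrightarrow> smooth (\<lambda>z. f z + g z)"
| smooth_mult: "smooth f \<Longrightarrow> smooth g \<Longrightarrow> smooth (\<lambda>z. f z * g z)"
| smooth_exp: "smooth f \<Longrightarrow> smooth (\<lambda>z. exp (f z))"
| smooth_inverse: "smooth f \<Longrightarrow> (\<And>z. z \<in> diamond \<Longrightarrow> f z \<noteq> 0) \<Longrightarrow> smooth (\<lambda>z. inverse (f z))"
| smooth_cong: "smooth f \<Longrightarrow> (\<And>z. z \<in> diamond \<Longrightarrow> f z = g z) \<Longrightarrow> smooth g"

lemmas smooth_basic = smooth_const smooth_coord smooth_add smooth_mult smooth_exp smooth_inverse

text \<open>The induction carries one common mixed derivative \<open>h\<close> along with both first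
  partials, so the symmetry of mixed derivatives comes out of the differentiation rules
  themselves.\<close>

lemma smooth_partials:
  "smooth f \<Longrightarrow> \<exists>f1 f2 h. smooth f1 \<and> smooth f2 \<and> has_pd 1 f f1 \<and> has_pd 2 f f2 \<and> has_pd 2 f1 h \<and> has_pd 1 f2 h"
proof (induction rule: smooth.induct)
  case (smooth_const c)
  then show ?case by (metis has_pd_const smooth.smooth_const)
next
  case (smooth_coord i)
  show ?case
    by (intro exI[of _ "\<lambda>z. if 1 = i then 1 else 0"] exI[of _ "\<lambda>z. if 2 = i then 1 else 0"] exI[of _ "\<lambda>z. 0"] conjI
        smooth.smooth_const has_pd_coord has_pd_const)
next
  case (smooth_add f g)
  then obtain f1 f2 h g1 g2 l where
    "smooth f1" "smooth f2" "has_pd 1 f f1" "has_pd 2 f f2" "has_pd 2 f1 h" "has_pd 1 f2 h"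
    "smooth g1" "smooth g2" "has_pd 1 g g1" "has_pd 2 g g2" "has_pd 2 g1 l" "has_pd 1 g2 l" by blast
  then show ?case
    by (intro exI[of _ "\<lambda>z. f1 z + g1 z"] exI[of _ "\<lambda>z. f2 z + g2 z"] exI[of _ "\<lambda>z. h z + l z"] conjI
        smooth.smooth_add has_pd_add)
next
  case (smooth_mult f g)
  then obtain f1 f2 h g1 g2 l where *:
    "smooth f1" "smooth f2" "has_pd 1 f f1" "has_pd 2 f f2" "has_pd 2 f1 h" "has_pd 1 f2 h"
    "smooth g1" "smooth g2" "has_pd 1 g g1" "has_pd 2 g g2" "has_pd 2 g1 l" "has_pd 1 g2 l" by blast
  show ?case
  proof (intro exI conjI)
    show "has_pd 1 (\<lambda>z. f z * g z) (\<lambda>z. f1 z * g z + f z * g1 z)"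
      "has_pd 2 (\<lambda>z. f z * g z) (\<lambda>z. f2 z * g z + f z * g2 z)"
      "smooth (\<lambda>z. f1 z * g z + f z * g1 z)" "smooth (\<lambda>z. f2 z * g z + f z * g2 z)"
      using * smooth_mult.hyps by (auto intro!: has_pd_mult smooth_basic)
    show "has_pd 2 (\<lambda>z. f1 z * g z + f z * g1 z) (\<lambda>z. (h z * g z + f1 z * g2 z) + (f2 z * g1 z + f z * l z))"
      using * by (intro has_pd_add has_pd_mult)
    \<comment> \<open>In the other order of differentiation the two middle terms appear
      exchanged.\<close>
    have "has_pd 1 (\<lambda>z. f2 z * g z + f z * g2 z) (\<lambda>z. (h z * g z + f2 z * g1 z) + (f1 z * g2 z + f z * l z))"
      using * by (intro has_pd_add has_pd_mult)
    then show "has_pd 1 (\<lambda>z. f2 z * g z + f z * g2 z) (\<lambda>z. (h z * g z + f1 z * g2 z) + (f2 z * g1 z + f z * l z))"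
      by (rule has_pd_cong) auto
  qed
next
  case (smooth_exp f)
  then obtain f1 f2 h where *:
    "smooth f1" "smooth f2" "has_pd 1 f f1" "has_pd 2 f f2" "has_pd 2 f1 h" "has_pd 1 f2 h" by blast
  show ?case
  proof (intro exI conjI)
    show "has_pd 1 (\<lambda>z. exp (f z)) (\<lambda>z. exp (f z) * f1 z)" "has_pd 2 (\<lambda>z. exp (f z)) (\<lambda>z. exp (f z) * f2 z)"
      "smooth (\<lambda>z. exp (f z) * f1 z)" "smooth (\<lambda>z. exp (f z) * f2 z)"
      using * smooth_exp.hyps by (auto intro!: has_pd_exp smooth_basic)
    show "has_pd 2 (\<lambda>z. exp (f z) * f1 z) (\<lambda>z. (exp (f z) * f2 z) * f1 z + exp (f z) * h z)"
      using * by (intro has_pd_mult has_pd_exp)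
    have "has_pd 1 (\<lambda>z. exp (f z) * f2 z) (\<lambda>z. (exp (f z) * f1 z) * f2 z + exp (f z) * h z)"
      using * by (intro has_pd_mult has_pd_exp)
    then show "has_pd 1 (\<lambda>z. exp (f z) * f2 z) (\<lambda>z. (exp (f z) * f2 z) * f1 z + exp (f z) * h z)"
      by (rule has_pd_cong) auto
  qed
next
  case (smooth_inverse f)
  then obtain f1 f2 h where *:
    "smooth f1" "smooth f2" "has_pd 1 f f1" "has_pd 2 f f2" "has_pd 2 f1 h" "has_pd 1 f2 h" by blast
  let ?r = "\<lambda>z. inverse (f z)"
  let ?d1 = "\<lambda>z. (-1) * (?r z * ?r z) * f1 z" let ?d2 = "\<lambda>z. (-1) * (?r z * ?r z) * f2 z"
  have d: "has_pd 1 ?r ?d1" "has_pd 2 ?r ?d2" "smooth ?d1" "smooth ?d2"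
    by (intro has_pd_inverse smooth_basic * smooth_inverse.hyps; assumption)+
  have "has_pd 2 ?d1 (\<lambda>z. (0 * (?r z * ?r z) + (-1) * (?d2 z * ?r z + ?r z * ?d2 z)) * f1 z + (-1) * (?r z * ?r z) * h z)"
    using * d by (intro has_pd_mult has_pd_const)
  moreover have "has_pd 1 ?d2 (\<lambda>z. (0 * (?r z * ?r z) + (-1) * (?d1 z * ?r z + ?r z * ?d1 z)) * f2 z + (-1) * (?r z * ?r z) * h z)"
    using * d by (intro has_pd_mult has_pd_const)
  then have "has_pd 1 ?d2 (\<lambda>z. (0 * (?r z * ?r z) + (-1) * (?d2 z * ?r z + ?r z * ?d2 z)) * f1 z + (-1) * (?r z * ?r z) * h z)"
    by (rule has_pd_cong) (auto simp: algebra_simps)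
  ultimately show ?case using d by blast
next
  case (smooth_cong f g)
  then show ?case by (metis has_pd_cong)
qed

lemma smooth_has_pd: assumes "smooth f" shows "has_pd i f (pd i f)"
proof -
  obtain g where "has_pd i f g" using smooth_partials[OF assms] exhaust_2[of i] by metis
  then show ?thesis by (rule has_pd_cong) (simp_all add: has_pd_pd[OF \<open>has_pd i f g\<close>])
qed

lemma smooth_pd: assumes "smooth f" shows "smooth (pd i f)"
proof -
  obtain g where g: "has_pd i f g" "smooth g" using smooth_partials[OF assms] exhaust_2[of i] by metis
  then show ?thesis by (auto intro: smooth_cong simp: has_pd_pd)
qed

lemma pd_commute: assumes "smooth f" "z \<in> diamond" shows "pd 1 (pd 2 f) z = pd 2 (pd 1 f) z"
proof -
  obtain f1 f2 h where *: "has_pd 1 f f1" "has_pd 2 f f2" "has_pd 2 f1 h" "has_pd 1 f2 h"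
    using smooth_partials[OF assms(1)] by blast
  have "pd 1 (pd 2 f) z = pd 1 f2 z" "pd 2 (pd 1 f) z = pd 2 f1 z"
    by (rule pd_cong[OF open_diamond assms(2)], simp add: has_pd_pd[OF *(2)] has_pd_pd[OF *(1)])+
  then show ?thesis using * assms(2) by (simp add: has_pd_pd)
qed

lemma smooth_continuous: "smooth f \<Longrightarrow> continuous_on diamond f"
  by (induction rule: smooth.induct) (auto intro!: continuous_intros cong: continuous_on_cong_simp)

lemma smooth_diff: "smooth f \<Longrightarrow> smooth g \<Longrightarrow> smooth (\<lambda>z. f z - g z)"
  using smooth_add[OF _ smooth_mult[OF smooth_const[of "-1"]]] by fastforce

lemma smooth_power: "smooth f \<Longrightarrow> smooth (\<lambda>z. f z ^ n)"
  by (induction n) (auto intro: smooth_basic)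

lemma smooth_divide: "smooth f \<Longrightarrow> smooth g \<Longrightarrow> (\<And>z. z \<in> diamond \<Longrightarrow> g z \<noteq> 0) \<Longrightarrow> smooth (\<lambda>z. f z / g z)"
  unfolding divide_inverse by (intro smooth_basic)

lemmas smooth_intros = smooth_const smooth_coord smooth_add smooth_mult smooth_exp smooth_diff smooth_power smooth_divide

lemma subspace_smooth: "subspace (Collect smooth)"
  by (auto simp: subspace_def zero_fun_def plus_fun_def scaleR_fun_def intro: smooth_basic)

lemma pd_add: "smooth f \<Longrightarrow> smooth g \<Longrightarrow> z \<in> diamond \<Longrightarrow> pd i (f + g) z = pd i f z + pd i g z"
  unfolding plus_fun_def by (intro has_pd_pd has_pd_add smooth_has_pd)

lemma pd_scaleR: assumes "smooth f" "z \<in> diamond" shows "pd i (c *\<^sub>R f) z = c * pd i f z"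
  using has_pd_pd[OF has_pd_mult[OF has_pd_const[of i c] smooth_has_pd[OF assms(1), of i]] assms(2)]
  by (simp add: scaleR_fun_def)

lemma pd_mult: "smooth f \<Longrightarrow> smooth g \<Longrightarrow> z \<in> diamond \<Longrightarrow> pd i (\<lambda>z. f z * g z) z = pd i f z * g z + f z * pd i g z"
  by (intro has_pd_pd has_pd_mult smooth_has_pd)

lemma pd_pd_add:
  assumes "smooth f" "smooth g" "z \<in> diamond" shows "pd j (pd i (f + g)) z = pd j (pd i f) z + pd j (pd i g) z"
proof -
  have "pd j (pd i (f + g)) z = pd j (pd i f + pd i g) z"
    by (rule pd_cong[OF open_diamond]) (use assms in \<open>auto simp: pd_add\<close>)
  then show ?thesis using assms by (simp add: pd_add smooth_pd)
qed

lemma pd_pd_scaleR: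
  assumes "smooth f" "z \<in> diamond" shows "pd j (pd i (c *\<^sub>R f)) z = c * pd j (pd i f) z"
proof -
  have "pd j (pd i (c *\<^sub>R f)) z = pd j (c *\<^sub>R pd i f) z"
    by (rule pd_cong[OF open_diamond]) (use assms in \<open>auto simp: pd_scaleR scaleR_fun_apply\<close>)
  then show ?thesis using assms by (simp add: pd_scaleR smooth_pd)
qed

section \<open>The Airy stress: linearity and vanishing divergence\<close>

lemma airy_nth:
  assumes "z \<in> K"
  shows "airy f z $ 1 $ 1 = pd 2 (pd 2 f) z" "airy f z $ 1 $ 2 = - pd 1 (pd 2 f) z"
    "airy f z $ 2 $ 1 = - pd 1 (pd 2 f) z" "airy f z $ 2 $ 2 = pd 1 (pd 1 f) z"
  using assms by (simp_all add: airy_def on_K_def)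

lemma airy_outside: "z \<notin> K \<Longrightarrow> airy f z = 0"
  by (simp add: airy_def on_K_def)

lemma airy_add: assumes "smooth f" "smooth g" shows "airy (f + g) = airy f + airy g"
proof
  fix z show "airy (f + g) z = (airy f + airy g) z"
  proof (cases "z \<in> K")
    case True
    then have "z \<in> diamond" using K_subset_diamond by auto
    then show ?thesis using True assms by (simp add: vec_eq_iff forall_2 airy_nth pd_pd_add)
  qed (simp add: airy_outside)
qed

lemma airy_scaleR: assumes "smooth f" shows "airy (c *\<^sub>R f) = c *\<^sub>R airy f"
proof
  fix z show "airy (c *\<^sub>R f) z = (c *\<^sub>R airy f) z"
  proof (cases "z \<in> K")
    case True
    then have "z \<in> diamond" using K_subset_diamond by auto
    then show ?thesis using True assms by (simp add: vec_eq_iff forall_2 airy_nth pd_pd_scaleR scaleR_fun_apply)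
  qed (simp add: airy_outside scaleR_fun_apply)
qed

text \<open>Each row is a difference of two third derivatives that agree up to order: d1 d2 d2
  against d2 d1 d2 in the first row, d2 d1 d1 against d1 d1 d2 in the second.\<close>

lemma rowdiv_airy: assumes "smooth f" shows "rowdiv (airy f) = 0"
proof
  fix z show "rowdiv (airy f) z = 0 z"
  proof (cases "z \<in> K")
    case True
    have D: "w \<in> diamond" if "w \<in> K" for w using that K_subset_diamond by auto
    have neg: "pd j (\<lambda>w. - g w) z = - pd j g z" if "smooth g" for g j
      using pd_scaleR[OF that D[OF True], of j "-1"] by (simp add: scaleR_fun_def)
    note c = pd_cong[OF open_K True]
    have "pd 1 (\<lambda>w. airy f w $ 1 $ 1) z = pd 1 (pd 2 (pd 2 f)) z"
      "pd 2 (\<lambda>w. airy f w $ 1 $ 2) z = pd 2 (\<lambda>w. - pd 1 (pd 2 f) w) z"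
      "pd 1 (\<lambda>w. airy f w $ 2 $ 1) z = pd 1 (\<lambda>w. - pd 1 (pd 2 f) w) z"
      "pd 2 (\<lambda>w. airy f w $ 2 $ 2) z = pd 2 (pd 1 (pd 1 f)) z"
      by (rule c, simp add: airy_nth)+
    moreover have "pd 1 (pd 2 (pd 2 f)) z = pd 2 (pd 1 (pd 2 f)) z"
      using assms D True by (intro pd_commute smooth_pd) auto
    moreover have "pd 2 (pd 1 (pd 1 f)) z = pd 1 (pd 2 (pd 1 f)) z"
      using assms D True by (intro pd_commute[symmetric] smooth_pd) auto
    \<comment> \<open>Here the commutation happens under a further derivative, so it is needed at
      all nearby points, not only at \<open>z\<close>.\<close>
    moreover have "pd 1 (pd 2 (pd 1 f)) z = pd 1 (pd 1 (pd 2 f)) z"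
      by (rule c) (use assms D in \<open>simp add: pd_commute\<close>)
    ultimately show ?thesis using True assms
      by (simp add: rowdiv_def on_K_def vec_eq_iff forall_2 sum_2 neg smooth_pd)
  qed (simp add: rowdiv_def on_K_def)
qed

subsection \<open>Edges and traces\<close>

definition edge_point :: "nat \<Rightarrow> real \<Rightarrow> real^2"
  where "edge_point e t = (if e = 1 then vector [0, t] else if e = 2 then vector [t, 0]
    else if e = 3 then vector [1, t] else vector [t, 1])"

definition tangent :: "nat \<Rightarrow> 2" where "tangent e = (if odd e then 2 else 1)"
definition normal :: "nat \<Rightarrow> 2" where "normal e = (if odd e then 1 else 2)"
text \<open>Edges 1 and 2 lie on the coordinate axes, where the outward normal points against the
  coordinate direction \<open>normal e\<close>.\<close>

definition edge_sign :: "nat \<Rightarrow> real" where "edge_sign e = (if e \<le> 2 then -1 else 1)"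

lemma edge_cases:
  assumes "e \<in> {1..4::nat}"
  obtains "e = 1" | "e = 2" | "e = 3" | "e = 4"
proof -
  have "e = 1 \<or> e = 2 \<or> e = 3 \<or> e = 4" using assms by auto
  then show ?thesis using that by blast
qed

lemma vec2_eq_iff: "(z::'a^2) = w \<longleftrightarrow> z$1 = w$1 \<and> z$2 = w$2"
  by (simp add: vec_eq_iff forall_2)

lemma closure_K: "z \<in> closure K \<longleftrightarrow> 0 \<le> z$1 \<and> z$1 \<le> 1 \<and> 0 \<le> z$2 \<and> z$2 \<le> 1"
proof -
  have "(vector [1/2, 1/2] :: real^2) \<in> K" by (simp add: mem_K)
  then have "box (0::real^2) 1 \<noteq> {}" by (auto simp: K_def)
  then have "closure K = cbox 0 1" by (simp add: K_def closure_box)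
  then show ?thesis by (auto simp: mem_box_cart forall_2)
qed

lemma frontier_K: "z \<in> frontier K \<longleftrightarrow> z \<in> closure K \<and> z \<notin> K"
  by (simp add: frontier_def interior_open[OF open_K])

lemma one_to_four: "{1..4::nat} = {1,2,3,4}" by auto

lemma mem_edge:
  "z \<in> edge e \<longleftrightarrow> z \<in> closure K \<and> z \<notin> K \<and> lam e z = 0 \<and> (\<forall>j\<in>{1,2,3,4} - {e}. lam j z \<noteq> 0)"
  unfolding edge_def one_to_four frontier_K by simp

lemma edge_eq: assumes "e \<in> {1..4}" shows "edge e = edge_point e ` {0<..<1}"
proof (intro set_eqI iffI)
  fix z
  show "z \<in> edge_point e ` {0<..<1}" if "z \<in> edge e"
  proof (rule image_eqI[of _ _ "z $ tangent e"])
    show "z = edge_point e (z $ tangent e)" "z $ tangent e \<in> {0<..<1}"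
      using assms that unfolding mem_edge closure_K mem_K
      by (cases rule: edge_cases;
          simp add: lam_def edge_point_def vec2_eq_iff tangent_def less_le insert_Diff_if; metis)+
  qed
  show "z \<in> edge_point e ` {0<..<1} \<Longrightarrow> z \<in> edge e"
    using assms
    by (cases rule: edge_cases, unfold mem_edge closure_K mem_K)
      (auto simp: lam_def edge_point_def)
qed

lemma edge_point_mem_edge:
  assumes "e \<in> {1..4}" "e' \<in> {1..4}" "t \<in> {0<..<1}"
  shows "edge_point e t \<in> edge e' \<longleftrightarrow> e = e'"
proof
  show "e = e' \<Longrightarrow> edge_point e t \<in> edge e'" using assms by (auto simp: edge_eq)
  assume "edge_point e t \<in> edge e'"
  then have "lam e' (edge_point e t) = 0" by (simp add: mem_edge)
  then show "e = e'" using assms(3)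
    by (rule_tac edge_cases[OF assms(1)]; rule_tac edge_cases[OF assms(2)])
      (auto simp: lam_def edge_point_def)
qed

lemma skeletonE:
  assumes "z \<in> skeleton"
  obtains e t where "e \<in> {1..4}" "t \<in> {0<..<1}" "z = edge_point e t"
  using assms by (auto simp: skeleton_def edge_eq)

lemma edge_point_skeleton: "e \<in> {1..4} \<Longrightarrow> t \<in> {0<..<1} \<Longrightarrow> edge_point e t \<in> skeleton"
  unfolding skeleton_def using edge_point_mem_edge by blast

lemma outward_normal_edge_point:
  assumes "e \<in> {1..4}" "t \<in> {0<..<1}"
  shows "outward_normal (edge_point e t) = edge_sign e *\<^sub>R axis (normal e) 1"
proof -
  have *: "edge_point e t \<in> edge 1 \<longleftrightarrow> e = 1" "edge_point e t \<in> edge 2 \<longleftrightarrow> e = 2"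
    "edge_point e t \<in> edge 3 \<longleftrightarrow> e = 3" "edge_point e t \<in> edge 4 \<longleftrightarrow> e = 4"
    by (intro edge_point_mem_edge assms; simp)+
  show ?thesis using assms(1) unfolding outward_normal_def *
    by (cases rule: edge_cases) (simp_all add: edge_sign_def normal_def)
qed

lemma skeleton_subset_diamond: "skeleton \<subseteq> diamond"
proof
  fix z assume "z \<in> skeleton"
  then obtain e t where et: "e \<in> {1..4}" "t \<in> {0<..<1}" "z = edge_point e t" by (rule skeletonE)
  then show "z \<in> diamond"
    by (rule_tac edge_cases[OF et(1)]) (auto simp: edge_point_def diamond_def)
qed

section \<open>Boundary values as limits from inside the square\<close>

lemma skeleton_islimpt: assumes "z \<in> skeleton" shows "z islimpt K"
proof -
  obtain e where "z \<in> edge e" using assms by (auto simp: skeleton_def)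
  then have "z \<in> closure K" "z \<notin> K" by (auto simp: mem_edge)
  then show ?thesis by (simp add: closure_def)
qed

text \<open>An edge point is a limit point of the square, so the limit is unique; it is computed by
  any function continuous at \<open>z\<close> that agrees with \<open>f\<close> inside.\<close>

lemma trace_bd_eqI:
  assumes "z \<in> skeleton" "isCont g z" "\<And>w. w \<in> K \<Longrightarrow> f w = g w"
  shows "trace_bd f z = g z"
proof -
  have "(g \<longlongrightarrow> g z) (at z within K)"
    using assms(2) by (auto simp: continuous_at intro: tendsto_within_subset)
  then have "(f \<longlongrightarrow> g z) (at z within K)"
    by (rule Lim_transform_eventually) (use assms(3) in \<open>auto simp: eventually_at_filter\<close>)
  then show ?thesis
    using assms(1) skeleton_islimpt[OF assms(1)] by (simp add: trace_bd_def tendsto_Lim trivial_limit_within)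
qed

text \<open>The Airy stress without the cut-off \<open>on_K\<close>. For smooth potentials it is
  continuous across the open edges and thus delivers the boundary values.\<close>

definition hess_airy :: "(real^2 \<Rightarrow> real) \<Rightarrow> real^2 \<Rightarrow> real^2^2"
  where "hess_airy f z = vector
    [vector [pd 2 (pd 2 f) z, - pd 1 (pd 2 f) z], vector [- pd 1 (pd 2 f) z, pd 1 (pd 1 f) z]]"

lemma isCont_hess_airy: assumes "smooth f" "z \<in> diamond" shows "isCont (hess_airy f) z"
proof -
  have c: "isCont (pd i (pd j f)) z" for i j
    using smooth_continuous[OF smooth_pd[OF smooth_pd[OF assms(1)]]] assms(2) open_diamond
    by (simp add: continuous_on_eq_continuous_at)
  have "((\<lambda>w. hess_airy f w $ i $ j) \<longlongrightarrow> hess_airy f z $ i $ j) (at z)" for i j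
    using exhaust_2[of i] exhaust_2[of j] c[unfolded isCont_def]
    by (auto simp: hess_airy_def intro!: tendsto_minus)
  then show ?thesis unfolding isCont_def by (intro vec_tendstoI)
qed

lemma normal_trace_outside: "z \<notin> skeleton \<Longrightarrow> normal_trace \<tau> z = 0"
  by (simp add: normal_trace_def trace_bd_def)

lemma normal_trace_airy:
  assumes "smooth f" "z \<in> skeleton"
  shows "normal_trace (airy f) z = hess_airy f z *v outward_normal z"
proof -
  have "trace_bd (airy f) z = hess_airy f z"
    using assms skeleton_subset_diamond
    by (intro trace_bd_eqI isCont_hess_airy) (auto simp: vec2_eq_iff airy_nth hess_airy_def)
  then show ?thesis by (simp add: normal_trace_def)
qed

lemma hess_airy_add: "smooth f \<Longrightarrow> smooth g \<Longrightarrow> z \<in> diamond \<Longrightarrow> hess_airy (f + g) z = hess_airy f z + hess_airy g z"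
  by (simp add: hess_airy_def vec2_eq_iff pd_pd_add)

lemma hess_airy_scaleR: "smooth f \<Longrightarrow> z \<in> diamond \<Longrightarrow> hess_airy (c *\<^sub>R f) z = c *\<^sub>R hess_airy f z"
  by (simp add: hess_airy_def vec2_eq_iff pd_pd_scaleR)

lemma normal_trace_airy_add:
  assumes "smooth f" "smooth g"
  shows "normal_trace (airy (f + g)) = normal_trace (airy f) + normal_trace (airy g)"
proof
  fix z show "normal_trace (airy (f + g)) z = (normal_trace (airy f) + normal_trace (airy g)) z"
  proof (cases "z \<in> skeleton")
    case True
    moreover have "smooth (f + g)" using assms by (simp add: plus_fun_def smooth_add)
    ultimately show ?thesis using assms skeleton_subset_diamond
      by (simp add: normal_trace_airy hess_airy_add matrix_vector_mult_add_rdistrib subset_iff)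
  qed (simp add: normal_trace_outside)
qed

lemma normal_trace_airy_scaleR:
  assumes "smooth f"
  shows "normal_trace (airy (c *\<^sub>R f)) = c *\<^sub>R normal_trace (airy f)"
proof
  fix z show "normal_trace (airy (c *\<^sub>R f)) z = (c *\<^sub>R normal_trace (airy f)) z"
  proof (cases "z \<in> skeleton")
    case True
    moreover have "smooth (c *\<^sub>R f)" using assms by (simp add: scaleR_fun_def smooth_basic)
    ultimately show ?thesis using assms skeleton_subset_diamond
      by (simp add: normal_trace_airy hess_airy_scaleR scaleR_fun_apply subset_iff scaleR_matrix_vector_assoc)
  qed (simp add: normal_trace_outside scaleR_fun_apply)
qed

lemma airy_span: assumes "\<And>f. f \<in> A \<Longrightarrow> smooth f" shows "airy ` span A = span (airy ` A)"
  by (rule image_span_linear_on[OF subspace_smooth]) (use assms in \<open>auto simp: airy_add airy_scaleR\<close>)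

lemma normal_trace_airy_span:
  assumes "\<And>f. f \<in> A \<Longrightarrow> smooth f"
  shows "normal_trace ` airy ` span A = span (normal_trace ` airy ` A)"
  unfolding image_image
  by (rule image_span_linear_on[OF subspace_smooth])
    (use assms in \<open>auto simp: normal_trace_airy_add normal_trace_airy_scaleR\<close>)

text \<open>\<open>f e\<close> and \<open>d e\<close> are the values of \<open>\<phi>\<close> and of its derivative in the direction of the
  coordinate normal to the edge \<open>e\<close> (which points inwards for \<open>e \<le> 2\<close>).\<close>

definition boundary_data :: "(real^2 \<Rightarrow> real) \<Rightarrow> (nat \<Rightarrow> real poly) \<Rightarrow> (nat \<Rightarrow> real poly) \<Rightarrow> bool"
  where "boundary_data \<phi> f d \<longleftrightarrow> smooth \<phi> \<and> (\<forall>e\<in>{1..4}. \<forall>t\<in>{0<..<1}.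
    \<phi> (edge_point e t) = poly (f e) t \<and> pd (normal e) \<phi> (edge_point e t) = poly (d e) t)"

text \<open>Up to the orientation sign, the component across the edge (the first on odd, vertical
  edges, the second on even ones) is f'' and the component along the edge is -d'.\<close>

definition edge_traction :: "nat \<Rightarrow> real poly \<Rightarrow> real poly \<Rightarrow> real \<Rightarrow> real^2"
  where "edge_traction e f d t = edge_sign e *\<^sub>R
    (if odd e then vector [poly (pderiv (pderiv f)) t, - poly (pderiv d) t]
     else vector [- poly (pderiv d) t, poly (pderiv (pderiv f)) t])"

lemma pd_tangent:
  assumes e: "e \<in> {1..4}" and t: "t \<in> {0<..<1}"
    and f: "\<And>s. s \<in> {0<..<1} \<Longrightarrow> f (edge_point e s) = poly p s"
  shows "pd (tangent e) f (edge_point e t) = poly (pderiv p) t"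
proof -
  have line: "edge_point e t + s *\<^sub>R axis (tangent e) 1 = edge_point e (t + s)" for s
    using e by (cases rule: edge_cases) (simp_all add: edge_point_def tangent_def vec2_eq_iff axis_def)
  have "((\<lambda>s. poly p (t + s)) has_real_derivative poly (pderiv p) t) (at 0)"
    by (auto intro!: derivative_eq_intros DERIV_chain2[OF poly_DERIV])
  \<comment> \<open>\<open>t\<close> lies inside the open interval, so small shifts stay on the
    edge, where \<open>f\<close> is given by \<open>p\<close>.\<close>
  moreover have "eventually (\<lambda>s. f (edge_point e (t + s)) = poly p (t + s)) (nhds 0)"
  proof -
    have "((\<lambda>s. t + s) \<longlongrightarrow> t + 0) (nhds 0)" by (intro tendsto_intros filterlim_ident)
    then have "eventually (\<lambda>s. t + s \<in> {0<..<1}) (nhds 0)"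
      using t by (intro topological_tendstoD[of _ "t + 0"]) auto
    then show ?thesis by (rule eventually_mono) (rule f)
  qed
  ultimately have "((\<lambda>s. f (edge_point e (t + s))) has_real_derivative poly (pderiv p) t) (at 0)"
    by (subst DERIV_cong_ev[OF refl _ refl])
  then show ?thesis unfolding pd_def line by (rule DERIV_imp_deriv)
qed

text \<open>The normal selects a column of the stress in which every entry contains a tangential
  derivative and is therefore determined by the data on the edge. On vertical edges the mixed
  derivative has the normal one outermost and must be commuted first.\<close>

lemma normal_trace_boundary_data:
  assumes bd: "boundary_data \<phi> f d" and e: "e \<in> {1..4}" and t: "t \<in> {0<..<1}"
  shows "normal_trace (airy \<phi>) (edge_point e t) = edge_traction e (f e) (d e) t"
proof -
  let ?z = "edge_point e t"
  have sm: "smooth \<phi>" using bd by (simp add: boundary_data_def)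
  have z: "?z \<in> skeleton" using edge_point_skeleton[OF e t] .
  have zd: "?z \<in> diamond" using z skeleton_subset_diamond by auto
  have tt: "pd (tangent e) (pd (tangent e) \<phi>) ?z = poly (pderiv (pderiv (f e))) t"
    by (intro pd_tangent e t) (use bd e in \<open>auto simp: boundary_data_def\<close>)
  have tn: "pd (tangent e) (pd (normal e) \<phi>) ?z = poly (pderiv (d e)) t"
    by (intro pd_tangent e t) (use bd e in \<open>auto simp: boundary_data_def\<close>)
  show ?thesis
    unfolding normal_trace_airy[OF sm z] outward_normal_edge_point[OF e t] edge_traction_def
    using tt tn pd_commute[OF sm zd]
    by (auto simp: vec2_eq_iff hess_airy_def tangent_def normal_def matrix_vector_mult_def sum_2 axis_def
        split: if_splits)
qed

subsection \<open>Boundary data of the generators\<close>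

lemma pd_eqI: "((\<lambda>t. f (z + t *\<^sub>R axis i 1)) has_real_derivative d) (at 0) \<Longrightarrow> pd i f z = d"
  unfolding pd_def by (rule DERIV_imp_deriv)

lemma smooth_poly: "smooth (\<lambda>z. poly p (z$i))"
  by (induction p) (auto intro!: smooth_basic)

lemma pd_poly: "z \<in> diamond \<Longrightarrow> pd i (\<lambda>z. poly p (z$j)) z = (if i = j then poly (pderiv p) (z$j) else 0)"
  by (rule pd_eqI) (auto simp: axis_def intro!: derivative_eq_intros DERIV_chain2[OF poly_DERIV])

lemma smooth_lam: "smooth (lam i)"
proof -
  have "lam i = (\<lambda>z. if i = 1 then z$1 else if i = 2 then z$2 else if i = 3 then 1 - z$1 else 1 - z$2)"
    by (simp add: lam_def fun_eq_iff)
  then show ?thesis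
    by (cases "i = 1"; cases "i = 2"; cases "i = 3") (simp_all add: smooth_coord smooth_diff smooth_const)
qed

lemma lam_edge_point: "e \<in> {1..4} \<Longrightarrow> lam e (edge_point e t) = 0"
  by (erule edge_cases) (simp_all add: lam_def edge_point_def)

lemma pd_normal_lam: "e \<in> {1..4} \<Longrightarrow> pd (normal e) (lam e) z = - edge_sign e"
  by (erule edge_cases; rule pd_eqI)
    (auto simp: lam_def normal_def edge_sign_def axis_def intro!: derivative_eq_intros)

lemma lam_add_pos: "i \<in> {1..4} \<Longrightarrow> j \<in> {1..4} \<Longrightarrow> i \<noteq> j \<Longrightarrow> z \<in> diamond \<Longrightarrow> lam i z + lam j z > 0"
  by (erule edge_cases; erule edge_cases) (auto simp: lam_def diamond_def)

section \<open>The rational bubbles on the edges\<close>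

lemma pd_simple_zero:
  assumes "smooth l" "smooth r" "z \<in> diamond" "l z = 0"
  shows "pd i (\<lambda>z. l z * r z) z = pd i l z * r z"
  using assms by (simp add: pd_mult)

lemma pd_double_zero:
  assumes "smooth l" "smooth r" "z \<in> diamond" "l z = 0"
  shows "pd i (\<lambda>z. (l z)^2 * r z) z = 0"
  using pd_simple_zero[of l "\<lambda>z. l z * r z" z i] assms
  by (simp add: power2_eq_square mult.assoc smooth_mult)

text \<open>Pairing each \<open>lam m\<close> of the bubble with the fraction of the same index
  exhibits \<open>B i\<close> as vanishing to first order on edge \<open>i\<close> and to second
  order on the other edges.\<close>

definition B_factor :: "nat \<Rightarrow> nat \<Rightarrow> real^2 \<Rightarrow> real"
  where "B_factor i m z = (lam m z)^2 / (lam m z + lam i z)"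

lemma B_eq: assumes "i \<in> {1..4}" shows "B i z = lam i z * (\<Prod>m\<in>{1..4} - {i}. B_factor i m z)"
proof -
  have "(\<Prod>m\<in>{1..4}. lam m z) = lam i z * (\<Prod>m\<in>{1..4} - {i}. lam m z)"
    using assms by (subst prod.remove[of _ i]) auto
  then show ?thesis
    by (simp add: B_def B_factor_def power2_eq_square mult.assoc prod.distrib[symmetric])
qed

lemma smooth_prod: "(\<And>i. i \<in> I \<Longrightarrow> smooth (f i)) \<Longrightarrow> smooth (\<lambda>z. \<Prod>i\<in>I. f i z)"
  by (induction I rule: infinite_finite_induct) (auto intro: smooth_basic)

lemma smooth_B_factor: "i \<in> {1..4} \<Longrightarrow> m \<in> {1..4} \<Longrightarrow> i \<noteq> m \<Longrightarrow> smooth (B_factor i m)"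
  unfolding B_factor_def
  by (intro smooth_divide smooth_power smooth_add smooth_lam) (metis lam_add_pos less_irrefl)

lemma smooth_B: assumes "i \<in> {1..4}" shows "smooth (B i)"
  unfolding B_eq[OF assms, abs_def]
  using assms by (intro smooth_mult smooth_lam smooth_prod smooth_B_factor) auto

lemma edge_point_diamond: "e \<in> {1..4} \<Longrightarrow> t \<in> {0<..<1} \<Longrightarrow> edge_point e t \<in> diamond"
  using edge_point_skeleton skeleton_subset_diamond by blast

lemma B_edge_point:
  assumes i: "i \<in> {1..4}" and e: "e \<in> {1..4}" and t: "t \<in> {0<..<1}"
  shows "B i (edge_point e t) = 0"
    and "pd (normal e) (B i) (edge_point e t) = (if e = i then - edge_sign i * (t * (1 - t)) else 0)"
proof -
  let ?z = "edge_point e t"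
  note zd = edge_point_diamond[OF e t]
  have "B i ?z = 0 \<and> pd (normal e) (B i) ?z = (if e = i then - edge_sign i * (t * (1 - t)) else 0)"
  proof (cases "e = i")
    case True
    \<comment> \<open>On edge \<open>i\<close> the summand \<open>lam i\<close> of the denominator
      is zero. Of the three remaining factors the adjacent edges give t and 1 - t, the opposite edge
      gives 1.\<close>
    have "B_factor i m ?z = lam m ?z" if "m \<in> {1..4} - {i}" for m
      using lam_edge_point[OF e, of t] lam_add_pos[of m i ?z] that True zd i
      by (simp add: B_factor_def power2_eq_square)
    then have "(\<Prod>m\<in>{1..4} - {i}. B_factor i m ?z) = (\<Prod>m\<in>{1..4} - {i}. lam m ?z)" by simp
    also have "\<dots> = t * (1 - t)" unfolding one_to_four True using i
      by (cases rule: edge_cases) (auto simp: insert_Diff_if lam_def edge_point_def)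
    finally have p: "(\<Prod>m\<in>{1..4} - {i}. B_factor i m ?z) = t * (1 - t)" .
    have "pd (normal e) (B i) ?z = pd (normal e) (lam i) ?z * (\<Prod>m\<in>{1..4} - {i}. B_factor i m ?z)"
      unfolding B_eq[OF i, abs_def]
      using i zd lam_edge_point[OF e, of t] True
      by (intro pd_simple_zero smooth_lam smooth_prod smooth_B_factor) auto
    then show ?thesis using True pd_normal_lam[OF i] lam_edge_point[OF e, of t] p by (simp add: B_eq[OF i])
  next
    \<comment> \<open>On any other edge a squared factor can be split off, which annihilates both
      the value and the normal derivative.\<close>
    case False
    have eq: "B i z = (lam e z)^2 * (inverse (lam e z + lam i z) * (lam i z * (\<Prod>m\<in>{1..4} - {i} - {e}. B_factor i m z)))" for z
      unfolding B_eq[OF i] using e False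
      by (subst prod.remove[of _ e]) (auto simp: B_factor_def divide_inverse)
    have "pd (normal e) (B i) ?z = 0"
      unfolding eq[abs_def]
    proof (intro pd_double_zero)
      show "smooth (\<lambda>z. inverse (lam e z + lam i z) * (lam i z * (\<Prod>m\<in>{1..4} - {i} - {e}. B_factor i m z)))"
        using i by (intro smooth_mult smooth_inverse smooth_add smooth_lam smooth_prod smooth_B_factor)
          (use False e lam_add_pos[of e i] in \<open>auto simp: less_le\<close>)
    qed (use smooth_lam zd lam_edge_point[OF e, of t] in auto)
    then show ?thesis using False lam_edge_point[OF e, of t] by (simp add: eq)
  qed
  then show "B i (edge_point e t) = 0"
    and "pd (normal e) (B i) (edge_point e t) = (if e = i then - edge_sign i * (t * (1 - t)) else 0)" by auto
qed

section \<open>Tensor product potentials\<close>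

definition edge_coord :: "nat \<Rightarrow> real" where "edge_coord e = (if e \<le> 2 then 0 else 1)"

definition tensor :: "real poly \<Rightarrow> real poly \<Rightarrow> real^2 \<Rightarrow> real"
  where "tensor p q z = poly p (z$1) * poly q (z$2)"

definition tensor_val :: "real poly \<Rightarrow> real poly \<Rightarrow> nat \<Rightarrow> real poly"
  where "tensor_val p q e = (if odd e then smult (poly p (edge_coord e)) q else smult (poly q (edge_coord e)) p)"

definition tensor_der :: "real poly \<Rightarrow> real poly \<Rightarrow> nat \<Rightarrow> real poly"
  where "tensor_der p q e = (if odd e then smult (poly (pderiv p) (edge_coord e)) q
    else smult (poly (pderiv q) (edge_coord e)) p)"

lemma smooth_tensor: "smooth (tensor p q)"
  unfolding tensor_def[abs_def] by (intro smooth_mult smooth_poly)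

lemma pd_tensor:
  assumes "z \<in> diamond"
  shows "pd 1 (tensor p q) z = tensor (pderiv p) q z" "pd 2 (tensor p q) z = tensor p (pderiv q) z"
  unfolding tensor_def[abs_def] using assms by (simp_all add: pd_mult smooth_poly pd_poly)

lemma boundary_data_tensor: "boundary_data (tensor p q) (tensor_val p q) (tensor_der p q)"
  unfolding boundary_data_def
proof (intro conjI ballI smooth_tensor)
  fix e t assume e: "e \<in> {1..4::nat}" and t: "t \<in> {0<..<1::real}"
  note zd = edge_point_diamond[OF e t]
  show "tensor p q (edge_point e t) = poly (tensor_val p q e) t"
    using e by (cases rule: edge_cases) (simp_all add: tensor_def tensor_val_def edge_point_def edge_coord_def)
  show "pd (normal e) (tensor p q) (edge_point e t) = poly (tensor_der p q e) t"
    using e pd_tensor[OF zd, of p q]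
    by (cases rule: edge_cases) (simp_all add: normal_def tensor_def tensor_der_def edge_point_def edge_coord_def)
qed

text \<open>Formal names of the potentials, so that they can index a family before being known to be
  distinct: monomials, corner functions, rational bubbles (\<open>SingX\<close> is
  \<open>B 4\<close> times x), and the generators exponential in y and in x.\<close>

datatype gen_index = Mon nat nat | Cor nat nat | Sing2 | Sing3 | Sing4 | SingX | ExpY | ExpX

text \<open>The double zero at 0 removes value and slope there. At 1 only exponent 0 leaves a value,
  and only exponents 0 and 1 leave a slope.\<close>

definition corner_poly :: "nat \<Rightarrow> real poly"
  where "corner_poly i = monom 1 2 * [:1, -1:] ^ i"

fun gen :: "nat \<Rightarrow> gen_index \<Rightarrow> real^2 \<Rightarrow> real" where
  "gen k (Mon i j) = tensor (monom 1 i) (monom 1 j)"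
| "gen k (Cor i j) = tensor (corner_poly i) (corner_poly j)"
| "gen k Sing2 = B 2"
| "gen k Sing3 = B 3"
| "gen k Sing4 = B 4"
| "gen k SingX = (\<lambda>z. B 4 z * z$1)"
| "gen k ExpY = (\<lambda>z. (z$1 * exp (1 - z$2) * z$2)^2 * (1 - z$1)^k)"
| "gen k ExpX = (\<lambda>z. (exp (1 - z$1) * z$1 * z$2)^2 * (1 - z$2)^k)"

fun gen_val :: "nat \<Rightarrow> gen_index \<Rightarrow> nat \<Rightarrow> real poly" where
  "gen_val k (Mon i j) = tensor_val (monom 1 i) (monom 1 j)"
| "gen_val k (Cor i j) = tensor_val (corner_poly i) (corner_poly j)"
| "gen_val k ExpY = (\<lambda>e. if e = 4 then corner_poly k else 0)"
| "gen_val k ExpX = (\<lambda>e. if e = 3 then corner_poly k else 0)"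
| "gen_val k _ = (\<lambda>e. 0)"

fun gen_der :: "nat \<Rightarrow> gen_index \<Rightarrow> nat \<Rightarrow> real poly" where
  "gen_der k (Mon i j) = tensor_der (monom 1 i) (monom 1 j)"
| "gen_der k (Cor i j) = tensor_der (corner_poly i) (corner_poly j)"
| "gen_der k Sing2 = (\<lambda>e. if e = 2 then [:0, 1, -1:] else 0)"
| "gen_der k Sing3 = (\<lambda>e. if e = 3 then [:0, -1, 1:] else 0)"
| "gen_der k Sing4 = (\<lambda>e. if e = 4 then [:0, -1, 1:] else 0)"
| "gen_der k SingX = (\<lambda>e. if e = 4 then - corner_poly 1 else 0)"
| "gen_der k _ = (\<lambda>e. 0)"

lemma boundary_data_B:
  assumes "i \<in> {1..4}"
  shows "boundary_data (B i) (\<lambda>e. 0) (\<lambda>e. if e = i then smult (- edge_sign i) [:0, 1, -1:] else 0)"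
  unfolding boundary_data_def using assms
  by (auto simp: smooth_B B_edge_point algebra_simps)

lemma poly_corner_poly: "poly (corner_poly i) t = t^2 * (1 - t)^i"
  by (simp add: corner_poly_def poly_monom)

text \<open>The factor y exp(1 - y) has value 1 and slope 0 at y = 1. So \<open>ExpY\<close> has the
  value \<open>corner_poly k\<close> and no normal derivative on that edge, and a zero of order at
  least two on each other edge. \<open>ExpX\<close> is the mirror image.\<close>

lemma boundary_data_exp:
  assumes "k \<ge> 2"
  shows "boundary_data (gen k ExpY) (gen_val k ExpY) (gen_der k ExpY)"
    "boundary_data (gen k ExpX) (gen_val k ExpX) (gen_der k ExpX)"
proof -
  \<comment> \<open>Both facts express that the power with exponent \<open>k\<close> has at least a
    double zero at the far edge.\<close>
  have k: "0 < k" "(0::real)^(k - Suc 0) = 0" using assms by auto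
  show "boundary_data (gen k ExpY) (gen_val k ExpY) (gen_der k ExpY)"
    unfolding boundary_data_def
  proof (intro conjI ballI)
    show "smooth (gen k ExpY)" unfolding gen.simps by (intro smooth_intros)
    fix e t assume e: "e \<in> {1..4::nat}" and t: "t \<in> {0<..<1::real}"
    show "gen k ExpY (edge_point e t) = poly (gen_val k ExpY e) t"
      using e k by (cases rule: edge_cases) (simp_all add: edge_point_def poly_corner_poly)
    show "pd (normal e) (gen k ExpY) (edge_point e t) = poly (gen_der k ExpY e) t"
      using e k by (cases rule: edge_cases)
        (auto simp: edge_point_def normal_def axis_def power_0_left intro!: pd_eqI derivative_eq_intros)
  qed
  show "boundary_data (gen k ExpX) (gen_val k ExpX) (gen_der k ExpX)"
    unfolding boundary_data_def
  proof (intro conjI ballI)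
    show "smooth (gen k ExpX)" unfolding gen.simps by (intro smooth_intros)
    fix e t assume e: "e \<in> {1..4::nat}" and t: "t \<in> {0<..<1::real}"
    show "gen k ExpX (edge_point e t) = poly (gen_val k ExpX e) t"
      using e k by (cases rule: edge_cases) (simp_all add: edge_point_def poly_corner_poly)
    show "pd (normal e) (gen k ExpX) (edge_point e t) = poly (gen_der k ExpX e) t"
      using e k by (cases rule: edge_cases)
        (auto simp: edge_point_def normal_def axis_def power_0_left intro!: pd_eqI derivative_eq_intros)
  qed
qed

lemma boundary_data_SingX: "boundary_data (gen k SingX) (gen_val k SingX) (gen_der k SingX)"
  unfolding boundary_data_def
proof (intro conjI ballI)
  have sm: "smooth (B 4)" by (simp add: smooth_B)
  show "smooth (gen k SingX)" unfolding gen.simps by (intro smooth_mult smooth_coord sm)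
  fix e t assume e: "e \<in> {1..4::nat}" and t: "t \<in> {0<..<1::real}"
  note b = B_edge_point[OF _ e t, of 4]
  show "gen k SingX (edge_point e t) = poly (gen_val k SingX e) t" using b by simp
  have "pd (normal e) (gen k SingX) (edge_point e t) = pd (normal e) (B 4) (edge_point e t) * edge_point e t $ 1"
    unfolding gen.simps using b by (intro pd_simple_zero sm smooth_coord edge_point_diamond[OF e t]) auto
  then show "pd (normal e) (gen k SingX) (edge_point e t) = poly (gen_der k SingX e) t"
    using b by (auto simp: edge_sign_def poly_corner_poly edge_point_def power2_eq_square)
qed

lemma boundary_data_gen:
  assumes "k \<ge> 2" shows "boundary_data (gen k i) (gen_val k i) (gen_der k i)"
proof (cases i)
  case (Mon a b) then show ?thesis by (simp add: boundary_data_tensor)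
next
  case (Cor a b) then show ?thesis by (simp add: boundary_data_tensor)
qed (use boundary_data_B[of 2] boundary_data_B[of 3] boundary_data_B[of 4] boundary_data_exp[OF assms]
    boundary_data_SingX[of k] in \<open>simp_all add: edge_sign_def cong: if_cong\<close>)

lemma smooth_gen: "k \<ge> 2 \<Longrightarrow> smooth (gen k i)"
  using boundary_data_gen by (auto simp: boundary_data_def)

section \<open>Linear combinations of boundary data\<close>

lemma boundary_data_add:
  assumes "boundary_data g f d" "boundary_data g' f' d'"
  shows "boundary_data (g + g') (\<lambda>e. f e + f' e) (\<lambda>e. d e + d' e)"
proof -
  have sm: "smooth g" "smooth g'" using assms by (auto simp: boundary_data_def)
  then have "smooth (g + g')" unfolding plus_fun_def by (rule smooth_add)
  then show ?thesis using assms unfolding boundary_data_def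
    by (simp add: pd_add[OF sm] edge_point_diamond)
qed

lemma boundary_data_scaleR:
  assumes "boundary_data g f d"
  shows "boundary_data (c *\<^sub>R g) (\<lambda>e. smult c (f e)) (\<lambda>e. smult c (d e))"
proof -
  have sm: "smooth g" using assms by (auto simp: boundary_data_def)
  then have "smooth (c *\<^sub>R g)" by (simp add: scaleR_fun_def smooth_basic)
  then show ?thesis using assms unfolding boundary_data_def
    by (simp add: pd_scaleR[OF sm] edge_point_diamond scaleR_fun_apply)
qed

lemma boundary_data_zero: "boundary_data 0 (\<lambda>e. 0) (\<lambda>e. 0)"
  unfolding boundary_data_def zero_fun_def
  by (simp add: smooth_const has_pd_pd[OF has_pd_const] edge_point_diamond)

lemma boundary_data_sum:
  assumes "\<And>i. i \<in> I \<Longrightarrow> boundary_data (g i) (f i) (d i)"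
  shows "boundary_data (\<Sum>i\<in>I. c i *\<^sub>R g i) (\<lambda>e. \<Sum>i\<in>I. smult (c i) (f i e)) (\<lambda>e. \<Sum>i\<in>I. smult (c i) (d i e))"
  using assms
proof (induction I rule: infinite_finite_induct)
  case (insert i I)
  then have "boundary_data (c i *\<^sub>R g i + (\<Sum>i\<in>I. c i *\<^sub>R g i))
    (\<lambda>e. smult (c i) (f i e) + (\<Sum>i\<in>I. smult (c i) (f i e))) (\<lambda>e. smult (c i) (d i e) + (\<Sum>i\<in>I. smult (c i) (d i e)))"
    by (intro boundary_data_add boundary_data_scaleR) auto
  then show ?case by (simp only: sum.insert[OF insert.hyps])
qed (simp_all only: sum.infinite sum.empty boundary_data_zero not_False_eq_True)

lemma poly_zero_on_interval: assumes "\<And>t::real. t \<in> {0<..<1} \<Longrightarrow> poly p t = 0" shows "p = 0"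
proof (rule ccontr)
  assume "p \<noteq> 0"
  then have "finite {t. poly p t = 0}" by (rule poly_roots_finite)
  moreover have "{0<..<1} \<subseteq> {t. poly p t = 0}" using assms by auto
  moreover have "infinite {0<..<1::real}" by (simp add: infinite_Ioo)
  ultimately show False using finite_subset by blast
qed

text \<open>Turns a vanishing trace into equations for single coefficients, the form used by the
  elimination. Only the affine part of \<open>f e\<close> and the constant part of
  \<open>d e\<close> stay undetermined.\<close>

lemma boundary_data_trace_zero:
  assumes "boundary_data \<phi> f d" "normal_trace (airy \<phi>) = 0" "e \<in> {1..4}"
  shows "n \<ge> 2 \<Longrightarrow> coeff (f e) n = 0" "n \<ge> 1 \<Longrightarrow> coeff (d e) n = 0"
proof -
  have t: "edge_traction e (f e) (d e) t = 0" if "t \<in> {0<..<1}" for t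
    using normal_trace_boundary_data[OF assms(1,3) that] assms(2) by simp
  have "poly (pderiv (pderiv (f e))) t = 0 \<and> poly (pderiv (d e)) t = 0" if "t \<in> {0<..<1}" for t
    using t[OF that]
    by (cases "odd e"; cases "e \<le> 2"; simp add: edge_traction_def edge_sign_def vec2_eq_iff)
  then have "pderiv (pderiv (f e)) = 0" "pderiv (d e) = 0"
    by (blast intro: poly_zero_on_interval)+
  then have c: "coeff (pderiv (pderiv (f e))) m = 0" "coeff (pderiv (d e)) m = 0" for m by simp_all
  show "coeff (f e) n = 0" if "n \<ge> 2"
    using c(1)[of "n - 2"] that by (simp add: coeff_pderiv Suc_diff_Suc numeral_2_eq_2)
  show "coeff (d e) n = 0" if "n \<ge> 1"
    using c(2)[of "n - 1"] that by (simp add: coeff_pderiv)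
qed

subsection \<open>Independence of the traces\<close>

lemma normal_trace_airy_sum:
  assumes "\<And>i. i \<in> I \<Longrightarrow> smooth (g i)"
  shows "normal_trace (airy (\<Sum>i\<in>I. c i *\<^sub>R g i)) = (\<Sum>i\<in>I. c i *\<^sub>R normal_trace (airy (g i)))"
  using assms
  by (intro sum_linear_on[OF subspace_smooth, where f="\<lambda>f. normal_trace (airy f)"])
    (auto simp: normal_trace_airy_add normal_trace_airy_scaleR)

lemma airy_sum:
  assumes "\<And>i. i \<in> I \<Longrightarrow> smooth (g i)"
  shows "airy (\<Sum>i\<in>I. c i *\<^sub>R g i) = (\<Sum>i\<in>I. c i *\<^sub>R airy (g i))"
  using assms by (intro sum_linear_on[OF subspace_smooth, where f=airy]) (simp_all only: mem_Collect_eq airy_add airy_scaleR)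

text \<open>Affine monomials are left out because their Airy stress is zero, corner functions with
  both exponents at least 2 because their traction is zero. The lower bound 2 in the fourth and
  sixth blocks avoids listing xy, or a corner function with both exponents below 2, a second
  time.\<close>

definition gen_indices :: "nat \<Rightarrow> gen_index set" where
  "gen_indices k = Mon 0 ` {2..k+2} \<union> Mon 1 ` {1..k+1} \<union> (\<lambda>i. Mon i 0) ` {2..k+2} \<union> (\<lambda>i. Mon i 1) ` {2..k+1} \<union>
    case_prod Cor ` ({..<2} \<times> {..<k}) \<union> case_prod Cor ` ({2..<k} \<times> {..<2}) \<union> {Sing2, Sing3, Sing4, SingX, ExpY, ExpX}"

lemma finite_gen_indices: "finite (gen_indices k)"
  by (simp add: gen_indices_def)

lemma Mon_gen_indices:
  "Mon i j \<in> gen_indices k \<longleftrightarrow> (i = 0 \<and> 2 \<le> j \<and> j \<le> k + 2) \<or> (i = 1 \<and> 1 \<le> j \<and> j \<le> k + 1) \<or>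
    (j = 0 \<and> 2 \<le> i \<and> i \<le> k + 2) \<or> (j = 1 \<and> 2 \<le> i \<and> i \<le> k + 1)"
  by (auto simp: gen_indices_def)

lemma Cor_gen_indices: "k \<ge> 2 \<Longrightarrow> Cor i j \<in> gen_indices k \<longleftrightarrow> i < k \<and> j < k \<and> (i < 2 \<or> j < 2)"
proof -
  have "Cor i j \<in> case_prod Cor ` S \<longleftrightarrow> (i, j) \<in> S" for S by force
  moreover have "Cor i j \<notin> Mon a ` T" "Cor i j \<notin> (\<lambda>i. Mon i b) ` T" for a b T by auto
  ultimately show "k \<ge> 2 \<Longrightarrow> Cor i j \<in> gen_indices k \<longleftrightarrow> i < k \<and> j < k \<and> (i < 2 \<or> j < 2)"
    unfolding gen_indices_def by (simp only: Un_iff mem_Sigma_iff) auto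
qed

text \<open>The blocks contribute 3 (k + 1) + k monomials, 2 k + 2 (k - 2) corner functions and six
  further generators.\<close>

lemma card_gen_indices: assumes "k \<ge> 2" shows "card (gen_indices k) = 8 * k + 5"
proof -
  have inj: "inj_on (Mon i) A" "inj_on (\<lambda>i. Mon i j) A" "inj_on (case_prod Cor) C" for i j A C
    by (auto simp: inj_on_def)
  have "card (gen_indices k) = card (Mon 0 ` {2..k+2}) + card (Mon 1 ` {1..k+1}) + card ((\<lambda>i. Mon i 0) ` {2..k+2}) +
    card ((\<lambda>i. Mon i 1) ` {2..k+1}) + card (case_prod Cor ` ({..<2} \<times> {..<k})) +
    card (case_prod Cor ` ({2..<k} \<times> {..<2})) + card {Sing2, Sing3, Sing4, SingX, ExpY, ExpX}"
    unfolding gen_indices_def by (subst card_Un_disjoint; (auto; fail)?)+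
  also have "\<dots> = 8 * k + 5" using assms by (simp add: card_image inj card_cartesian_product)
  finally show ?thesis .
qed

text \<open>One elimination step: if at degree \<open>n\<close> every other generator is invisible
  or already has weight zero, the equation isolates \<open>a j\<close>.\<close>

lemma coeff_lincomb_extract:
  fixes p :: "'i \<Rightarrow> real poly"
  assumes "coeff (\<Sum>i\<in>I. smult (a i) (p i)) n = 0" "finite I" "j \<notin> I \<Longrightarrow> a j = 0"
    "\<And>i. i \<noteq> j \<Longrightarrow> a i = 0 \<or> coeff (p i) n = 0" "coeff (p j) n \<noteq> 0"
  shows "a j = 0"
proof (cases "j \<in> I")
  case True
  have "(\<Sum>i\<in>I - {j}. a i * coeff (p i) n) = 0"
    by (rule sum.neutral) (use assms(4) in auto)
  then have "a j * coeff (p j) n = 0"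
    using assms(1,2) True by (simp add: coeff_sum sum.remove)
  then show ?thesis using assms(5) by simp
qed (use assms in auto)

text \<open>Reduces polynomials multiplied by the square of the variable to their expansion in powers of \<open>1 - t\<close>.\<close>

lemma corner_lincomb_zero:
  fixes p r :: "'i \<Rightarrow> real poly"
  assumes "\<And>n. n \<ge> 2 \<Longrightarrow> coeff (\<Sum>i\<in>I. smult (a i) (p i)) n = 0"
    "\<And>i. i \<in> I \<Longrightarrow> a i = 0 \<or> p i = monom 1 2 * pcompose (r i) [:1, -1:]"
  shows "(\<Sum>i\<in>I. smult (a i) (r i)) = 0"
proof -
  let ?R = "\<Sum>i\<in>I. smult (a i) (r i)"
  have "(\<Sum>i\<in>I. smult (a i) (p i)) = (\<Sum>i\<in>I. monom 1 2 * pcompose (smult (a i) (r i)) [:1, -1:])"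
  proof (rule sum.cong[OF refl])
    fix i assume "i \<in> I"
    from assms(2)[OF this] show "smult (a i) (p i) = monom 1 2 * pcompose (smult (a i) (r i)) [:1, -1:]"
      by (auto simp: pcompose_smult)
  qed
  also have "\<dots> = monom 1 2 * pcompose ?R [:1, -1:]"
    by (simp add: sum_distrib_left pcompose_sum)
  finally have eq: "(\<Sum>i\<in>I. smult (a i) (p i)) = monom 1 2 * pcompose ?R [:1, -1:]" .
  have "coeff (pcompose ?R [:1, -1:]) n = 0" for n
    using assms(1)[of "n + 2"] by (simp add: eq coeff_monom_mult)
  then have "pcompose ?R [:1, -1:] = 0" by (simp add: poly_eq_iff)
  then show ?thesis by (subst (asm) pcompose_eq_0_iff) auto
qed

lemma corner_poly_pcompose: "corner_poly i = monom 1 2 * pcompose (monom 1 i) [:1, -1:]"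
proof -
  have "poly (pcompose (monom 1 i) [:1, -1:]) t = poly ([:1, -1:] ^ i) t" for t :: real
    by (simp add: poly_pcompose poly_monom)
  then have "pcompose (monom 1 i) [:1, -1:] = [:1, -1::real:] ^ i" by (simp add: poly_eq_poly_eq_iff[symmetric] fun_eq_iff)
  then show ?thesis by (simp add: corner_poly_def)
qed

lemma poly_corner_poly_at: "poly (corner_poly i) 0 = 0" "poly (corner_poly i) 1 = 0 ^ i"
  by (simp_all add: poly_corner_poly)

lemma poly_pderiv_corner_poly:
  "poly (pderiv (corner_poly i)) 0 = 0"
  "poly (pderiv (corner_poly i)) 1 = 2 * 0 ^ i - of_nat i * 0 ^ (i - 1)"
  by (simp_all add: corner_poly_def pderiv_mult pderiv_power pderiv_monom poly_monom pderiv_pCons)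

lemma coeff_corner_poly_1: "coeff (corner_poly i) (Suc 0) = 0"
  by (simp add: corner_poly_def coeff_monom_mult)

text \<open>The system is triangular: each stage reads one kind of data on one edge, where every
  generator still visible is either isolated by its degree or already known to have weight
  zero.\<close>

lemma lin_indep_traces:
  assumes k: "k \<ge> 2"
  shows "lin_indep (\<lambda>i. normal_trace (airy (gen k i))) (gen_indices k)"
  unfolding lin_indep_def
proof (intro allI impI)
  fix c assume c0: "(\<Sum>i\<in>gen_indices k. c i *\<^sub>R normal_trace (airy (gen k i))) = 0"
  let ?I = "gen_indices k"
  \<comment> \<open>Weights are extended by zero, so that each stage can be stated for all
    exponents, inside the index set or not.\<close>
  define a where "a i = (if i \<in> ?I then c i else 0)" for i
  have a: "i \<notin> ?I \<Longrightarrow> a i = 0" for i by (simp add: a_def)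
  have "normal_trace (airy (\<Sum>i\<in>?I. a i *\<^sub>R gen k i)) = 0"
    using c0 by (simp add: normal_trace_airy_sum smooth_gen[OF k] a_def)
  note bd = boundary_data_trace_zero[OF boundary_data_sum[OF boundary_data_gen[OF k], where c=a and I="?I"] this]
  note val = bd(1) and der = bd(2)
  note X = coeff_lincomb_extract[OF _ finite_gen_indices[of k] a]
  note simps = tensor_val_def tensor_der_def edge_coord_def poly_monom pderiv_monom poly_corner_poly_at
    poly_pderiv_corner_poly coeff_corner_poly_1
  \<comment> \<open>On x = 0 the values see only the pure powers of y; next, the normal derivatives
    see only the monomials x y^n.\<close>
  have M0: "a (Mon 0 n) = 0" for n
  proof (cases "n \<ge> 2")
    case True
    show ?thesis
    proof (rule X[OF val[of 1]])
      show "a i = 0 \<or> coeff (gen_val k i 1) n = 0" if "i \<noteq> Mon 0 n" for i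
        using that by (cases i) (auto simp: simps)
    qed (use True in \<open>auto simp: simps\<close>)
  qed (auto intro!: a simp: Mon_gen_indices)
  have M1: "a (Mon 1 n) = 0" for n
  proof (cases "n \<ge> 1")
    case True
    show ?thesis
    proof (rule X[OF der[of 1]])
      show "a i = 0 \<or> coeff (gen_der k i 1) n = 0" if "i \<noteq> Mon 1 n" for i
        using that by (cases i) (auto simp: simps power_0_left)
    qed (use True in \<open>auto simp: simps\<close>)
  qed (auto intro!: a simp: Mon_gen_indices)
  have N0: "a (Mon n 0) = 0" for n
  proof (cases "n \<ge> 2")
    case True
    show ?thesis
    proof (rule X[OF val[of 2]])
      show "a i = 0 \<or> coeff (gen_val k i 2) n = 0" if "i \<noteq> Mon n 0" for i
        using that by (cases i) (auto simp: simps power_0_left)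
    qed (use True in \<open>auto simp: simps\<close>)
  qed (auto intro!: a simp: Mon_gen_indices)
  \<comment> \<open>The normal derivative on y = 0 sees the \<open>Mon n 1\<close> and
    \<open>Sing2\<close>, whose datum is t - t^2. At degree one the only competing monomial is xy,
    already eliminated.\<close>
  have S2: "a Sing2 = 0"
  proof (rule X[OF der[of 2]])
    show "a i = 0 \<or> coeff (gen_der k i 2) 1 = 0" if "i \<noteq> Sing2" for i
      using that M1 by (cases i) (auto simp: simps power_0_left)
  qed auto
  have N1: "a (Mon n 1) = 0" for n
  proof (cases "n \<ge> 2")
    case True
    show ?thesis
    proof (rule X[OF der[of 2]])
      show "a i = 0 \<or> coeff (gen_der k i 2) n = 0" if "i \<noteq> Mon n 1" for i
        using that S2 by (cases i) (auto simp: simps power_0_left)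
    qed (use True in \<open>auto simp: simps\<close>)
  next
    case False
    then have "n = 0 \<or> n = 1" by auto
    then show ?thesis using M0 M1 by auto
  qed
  have Mon: "a (Mon i j) = 0" for i j
  proof (cases "i = 0 \<or> i = 1 \<or> j = 0 \<or> j = 1")
    case False then show ?thesis by (auto intro!: a simp: Mon_gen_indices)
  qed (use M0 M1 N0 N1 in auto)
  have C_out: "a (Cor i j) = 0" if "i \<ge> k \<or> j \<ge> k" for i j
    using that by (auto intro!: a simp: Cor_gen_indices[OF k])
  \<comment> \<open>On x = 1 the values see the corner functions with first exponent 0 and
    \<open>ExpX\<close>. In powers of 1 - t, after removing t^2, those in the index set have degrees
    below \<open>k\<close> and \<open>ExpX\<close> has degree \<open>k\<close>.\<close>
  let ?r = "\<lambda>i. case i of Cor p j \<Rightarrow> if p = 0 then monom 1 j else 0 | ExpX \<Rightarrow> monom 1 k | _ \<Rightarrow> 0"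
  have r: "(\<Sum>i\<in>?I. smult (a i) (?r i)) = 0"
  proof (rule corner_lincomb_zero[where p="\<lambda>i. gen_val k i 3"])
    show "a i = 0 \<or> gen_val k i 3 = monom 1 2 * pcompose (?r i) [:1, -1:]" for i
      using Mon by (cases i) (auto simp: simps power_0_left corner_poly_pcompose[symmetric])
  qed (use val in auto)
  have C0: "a (Cor 0 n) = 0" for n
  proof (cases "n < k")
    case True show ?thesis
      by (rule X[where p="?r" and n=n]) (use True in \<open>auto simp: r split: gen_index.split\<close>)
  qed (use C_out in auto)
  have EX: "a ExpX = 0"
    by (rule X[where p="?r" and n=k]) (use C0 in \<open>auto simp: r split: gen_index.split\<close>)
  \<comment> \<open>Corner polynomials start at degree two, so degree one isolates
    \<open>Sing3\<close>.\<close>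
  have S3: "a Sing3 = 0"
  proof (rule X[OF der[of 3]])
    show "a i = 0 \<or> coeff (gen_der k i 3) 1 = 0" if "i \<noteq> Sing3" for i
      using that Mon by (cases i) (auto simp: simps)
  qed auto
  \<comment> \<open>The sign is the slope -1 of \<open>corner_poly 1\<close> at 1.
    \<open>corner_poly 0\<close> has a slope there too, but the weights \<open>Cor 0 n\<close> are
    already gone.\<close>
  let ?r = "\<lambda>i. case i of Cor p j \<Rightarrow> if p = 1 then - monom 1 j else 0 | _ \<Rightarrow> (0::real poly)"
  have r: "(\<Sum>i\<in>?I. smult (a i) (?r i)) = 0"
  proof (rule corner_lincomb_zero[where p="\<lambda>i. gen_der k i 3"])
    show "a i = 0 \<or> gen_der k i 3 = monom 1 2 * pcompose (?r i) [:1, -1:]" for i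
      using Mon C0 S3 by (cases i) (auto simp: simps le_Suc_eq power_0_left pcompose_uminus corner_poly_pcompose[symmetric])
  qed (use der in auto)
  have C1: "a (Cor 1 n) = 0" for n
    by (rule X[where p="?r" and n=n]) (auto simp: r split: gen_index.split)
  let ?r = "\<lambda>i. case i of Cor j p \<Rightarrow> if p = 0 then monom 1 j else 0 | ExpY \<Rightarrow> monom 1 k | _ \<Rightarrow> 0"
  have r: "(\<Sum>i\<in>?I. smult (a i) (?r i)) = 0"
  proof (rule corner_lincomb_zero[where p="\<lambda>i. gen_val k i 4"])
    show "a i = 0 \<or> gen_val k i 4 = monom 1 2 * pcompose (?r i) [:1, -1:]" for i
      using Mon by (cases i) (auto simp: simps power_0_left corner_poly_pcompose[symmetric])
  qed (use val in auto)
  have D0: "a (Cor n 0) = 0" for n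
  proof (cases "n < k")
    case True show ?thesis
      by (rule X[where p="?r" and n=n]) (use True in \<open>auto simp: r split: gen_index.split\<close>)
  qed (use C_out in auto)
  have EY: "a ExpY = 0"
    by (rule X[where p="?r" and n=k]) (use D0 in \<open>auto simp: r split: gen_index.split\<close>)
  have S4: "a Sing4 = 0"
  proof (rule X[OF der[of 4]])
    show "a i = 0 \<or> coeff (gen_der k i 4) 1 = 0" if "i \<noteq> Sing4" for i
      using that Mon by (cases i) (auto simp: simps)
  qed auto
  \<comment> \<open>On y = 1 \<open>SingX\<close> and \<open>Cor 1 1\<close> have the same normal
    derivative. They can be told apart because the weight of \<open>Cor 1 1\<close> was found to be
    zero from the data on x = 1.\<close>
  let ?r = "\<lambda>i. case i of Cor j p \<Rightarrow> if p = 1 then - monom 1 j else 0 | SingX \<Rightarrow> - monom 1 1 | _ \<Rightarrow> (0::real poly)"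
  have r: "(\<Sum>i\<in>?I. smult (a i) (?r i)) = 0"
  proof (rule corner_lincomb_zero[where p="\<lambda>i. gen_der k i 4"])
    show "a i = 0 \<or> gen_der k i 4 = monom 1 2 * pcompose (?r i) [:1, -1:]" for i
      using Mon D0 S4 by (cases i) (auto simp: simps le_Suc_eq power_0_left pcompose_uminus corner_poly_pcompose[symmetric])
  qed (use der in auto)
  have D1: "a (Cor n 1) = 0" for n
  proof (cases "n = 1")
    case False show ?thesis
      by (rule X[where p="?r" and n=n]) (use False in \<open>auto simp: r split: gen_index.split\<close>)
  qed (use C1 in auto)
  have SX: "a SingX = 0"
    by (rule X[where p="?r" and n=1]) (use C1 in \<open>auto simp: r split: gen_index.split\<close>)
  have Cor: "a (Cor i j) = 0" for i j
  proof (cases "i = 0 \<or> i = 1 \<or> j = 0 \<or> j = 1")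
    case False then show ?thesis by (auto intro!: a simp: Cor_gen_indices[OF k])
  qed (use C0 C1 D0 D1 in auto)
  have "a i = 0" for i using Mon Cor S2 S3 S4 SX EX EY by (cases i) auto
  then show "\<forall>i\<in>?I. c i = 0" by (metis a_def)
qed

subsection \<open>Bivariate polynomials\<close>

definition bipoly :: "nat \<Rightarrow> (nat \<Rightarrow> nat \<Rightarrow> real) \<Rightarrow> real^2 \<Rightarrow> real"
  where "bipoly n c z = (\<Sum>i\<le>n. \<Sum>j\<le>n. c i j * (z$1)^i * (z$2)^j)"

text \<open>Differentiation shifts coefficients while the bound stays \<open>n\<close>; the shift
  brings in coefficient n + 1 at the top, which has to vanish for the shortened sum to be
  complete.\<close>

lemma sum_deriv_shift:
  fixes f :: "nat \<Rightarrow> real" and x :: "nat \<Rightarrow> real"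
  assumes "f (Suc n) = 0"
  shows "(\<Sum>i\<le>n. f i * (of_nat i * x (i - 1))) = (\<Sum>i\<le>n. (of_nat i + 1) * f (Suc i) * x i)"
proof -
  have "(\<Sum>i\<le>n. f i * (of_nat i * x (i - 1))) = (\<Sum>i\<le>Suc n. f i * (of_nat i * x (i - 1)))"
    using assms by simp
  also have "\<dots> = (\<Sum>i\<le>n. (of_nat i + 1) * f (Suc i) * x i)"
    by (subst sum.atMost_Suc_shift) (simp add: algebra_simps)
  finally show ?thesis .
qed

lemma pd_bipoly:
  shows "(\<And>j. c (Suc n) j = 0) \<Longrightarrow> pd 1 (bipoly n c) z = bipoly n (\<lambda>i j. (of_nat i + 1) * c (Suc i) j) z"
    and "(\<And>i. c i (Suc n) = 0) \<Longrightarrow> pd 2 (bipoly n c) z = bipoly n (\<lambda>i j. (of_nat j + 1) * c i (Suc j)) z"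
proof -
  assume c: "\<And>j. c (Suc n) j = 0"
  have "pd 1 (bipoly n c) z = (\<Sum>i\<le>n. \<Sum>j\<le>n. c i j * (of_nat i * (z$1)^(i-1)) * (z$2)^j)"
    unfolding bipoly_def[abs_def]
    by (rule pd_eqI) (auto simp: axis_def intro!: derivative_eq_intros sum.cong)
  also have "\<dots> = (\<Sum>i\<le>n. (\<Sum>j\<le>n. c i j * (z$2)^j) * (of_nat i * (z$1)^(i-1)))"
    by (simp add: sum_distrib_left mult_ac)
  also have "\<dots> = (\<Sum>i\<le>n. (of_nat i + 1) * (\<Sum>j\<le>n. c (Suc i) j * (z$2)^j) * (z$1)^i)"
    by (rule sum_deriv_shift) (simp add: c)
  also have "\<dots> = bipoly n (\<lambda>i j. (of_nat i + 1) * c (Suc i) j) z"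
    by (simp add: bipoly_def sum_distrib_right sum_distrib_left mult_ac)
  finally show "pd 1 (bipoly n c) z = bipoly n (\<lambda>i j. (of_nat i + 1) * c (Suc i) j) z" .
next
  assume c: "\<And>i. c i (Suc n) = 0"
  have "pd 2 (bipoly n c) z = (\<Sum>i\<le>n. \<Sum>j\<le>n. c i j * (z$1)^i * (of_nat j * (z$2)^(j-1)))"
    unfolding bipoly_def[abs_def]
    by (rule pd_eqI) (auto simp: axis_def intro!: derivative_eq_intros sum.cong)
  also have "\<dots> = (\<Sum>i\<le>n. \<Sum>j\<le>n. (of_nat j + 1) * (c i (Suc j) * (z$1)^i) * (z$2)^j)"
    by (intro sum.cong refl sum_deriv_shift) (simp add: c)
  also have "\<dots> = bipoly n (\<lambda>i j. (of_nat j + 1) * c i (Suc j)) z"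
    by (simp add: bipoly_def mult_ac)
  finally show "pd 2 (bipoly n c) z = bipoly n (\<lambda>i j. (of_nat j + 1) * c i (Suc j)) z" .
qed

lemma power_sum_zero_on_interval:
  fixes a :: "nat \<Rightarrow> real"
  assumes "\<And>t. t \<in> {0<..<1} \<Longrightarrow> (\<Sum>i\<le>n. a i * t^i) = 0" "i \<le> n"
  shows "a i = 0"
proof -
  have "(\<Sum>i\<le>n. monom (a i) i) = 0"
    by (rule poly_zero_on_interval) (simp add: poly_sum poly_monom assms(1))
  then have "coeff (\<Sum>i\<le>n. monom (a i) i) i = 0" by simp
  then show ?thesis using assms(2) by (simp add: coeff_sum)
qed

text \<open>The one-variable statement is applied twice, first in x with y fixed and then in
  y.\<close>

lemma bipoly_zero:
  assumes "\<And>z. z \<in> K \<Longrightarrow> bipoly n c z = 0" "i \<le> n" "j \<le> n"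
  shows "c i j = 0"
proof (rule power_sum_zero_on_interval[where n=n and a="c i" and i=j])
  fix t :: real assume t: "t \<in> {0<..<1}"
  show "(\<Sum>j\<le>n. c i j * t^j) = 0"
  proof (rule power_sum_zero_on_interval[where n=n and i=i and a="\<lambda>i. \<Sum>j\<le>n. c i j * t^j"])
    fix s :: real assume s: "s \<in> {0<..<1}"
    show "(\<Sum>i\<le>n. (\<Sum>j\<le>n. c i j * t^j) * s^i) = 0"
      using assms(1)[of "vector [s, t]"] s t by (simp add: mem_K bipoly_def sum_distrib_left mult_ac)
  qed (rule assms)
qed (rule assms)

lemma bipoly_add: "bipoly n c z + bipoly n d z = bipoly n (\<lambda>i j. c i j + d i j) z"
  by (simp add: bipoly_def sum.distrib algebra_simps)

lemma bipoly_cmult: "r * bipoly n c z = bipoly n (\<lambda>i j. r * c i j) z"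
  by (simp add: bipoly_def sum_distrib_left algebra_simps)

lemma bipoly_uminus: "- bipoly n c z = bipoly n (\<lambda>i j. - c i j) z"
  using bipoly_cmult[of "-1"] by simp

lemma bipoly_extend:
  assumes "m \<le> n"
  shows "bipoly m c z = bipoly n (\<lambda>i j. if i \<le> m \<and> j \<le> m then c i j else 0) z"
proof -
  have "bipoly n (\<lambda>i j. if i \<le> m \<and> j \<le> m then c i j else 0) z =
    (\<Sum>i\<le>m. \<Sum>j\<le>n. (if i \<le> m \<and> j \<le> m then c i j else 0) * (z$1)^i * (z$2)^j)"
    unfolding bipoly_def by (rule sum.mono_neutral_right) (use assms in auto)
  also have "\<dots> = (\<Sum>i\<le>m. \<Sum>j\<le>m. c i j * (z$1)^i * (z$2)^j)"
    by (rule sum.cong[OF refl], rule sum.mono_neutral_cong_right) (use assms in auto)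
  finally show ?thesis by (simp add: bipoly_def)
qed

lemma bipoly_cong: "(\<And>i j. i \<le> n \<Longrightarrow> j \<le> n \<Longrightarrow> c i j = d i j) \<Longrightarrow> bipoly n c z = bipoly n d z"
  by (simp add: bipoly_def)

section \<open>Polynomial spaces and the Airy stress of tensor products\<close>

lemma Q_eq: "Q k = range (\<lambda>c. on_K (bipoly k c))"
  unfolding Q_def bipoly_def[abs_def] by auto

lemma Q_bipolyE:
  assumes "f \<in> Q k" "k \<le> n"
  obtains c where "\<And>z. z \<in> K \<Longrightarrow> f z = bipoly n c z" "\<And>i j. k < i \<or> k < j \<Longrightarrow> c i j = 0" "\<And>z. z \<notin> K \<Longrightarrow> f z = 0"
proof -
  obtain c where c: "f = on_K (bipoly k c)" using assms(1) by (auto simp: Q_eq)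
  show ?thesis
    by (rule that[of "\<lambda>i j. if i \<le> k \<and> j \<le> k then c i j else 0"])
      (auto simp: c on_K_def bipoly_extend[OF assms(2)])
qed

text \<open>The zero cases allow a factor of degree above \<open>k\<close> whose partner has been
  differentiated away, as happens for pure powers.\<close>

lemma tensor_in_Q:
  assumes "p = 0 \<or> q = 0 \<or> (degree p \<le> k \<and> degree q \<le> k)"
  shows "on_K (\<lambda>z. r * tensor p q z) \<in> Q k"
proof -
  have "\<exists>c. \<forall>z. r * tensor p q z = bipoly k c z"
  proof (cases "p = 0 \<or> q = 0")
    case True
    then show ?thesis by (intro exI[of _ "\<lambda>i j. 0"]) (auto simp: tensor_def bipoly_def)
  next
    case False
    then have d: "degree p \<le> k" "degree q \<le> k" using assms by auto
    have e: "poly p x = (\<Sum>i\<le>k. coeff p i * x^i)" if "degree p \<le> k" for p :: "real poly" and x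
      unfolding poly_altdef using that
      by (intro sum.mono_neutral_left) (auto intro: coeff_eq_0)
    show ?thesis
      by (intro exI[of _ "\<lambda>i j. r * (coeff p i * coeff q j)"])
        (simp add: tensor_def bipoly_def e[OF d(1)] e[OF d(2)] sum_product sum_distrib_left mult_ac,
          rule allI, subst sum.swap, rule refl)
  qed
  then obtain c where "\<And>z. r * tensor p q z = bipoly k c z" by blast
  then show ?thesis unfolding Q_eq by (intro range_eqI[of _ _ c]) simp
qed

lemma subspace_Q: "subspace (Q k)"
  unfolding subspace_def
proof (intro conjI ballI allI)
  show "0 \<in> Q k" unfolding Q_eq
    by (rule range_eqI[of _ _ "\<lambda>i j. 0"]) (simp add: fun_eq_iff on_K_def bipoly_def)
  fix f g r assume "f \<in> Q k"
  then obtain c where c: "f = on_K (bipoly k c)" by (auto simp: Q_eq)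
  show "r *\<^sub>R f \<in> Q k" unfolding Q_eq c
    by (rule range_eqI[of _ _ "\<lambda>i j. r * c i j"]) (simp add: fun_eq_iff on_K_def scaleR_fun_apply bipoly_cmult)
  assume "g \<in> Q k"
  then obtain d where d: "g = on_K (bipoly k d)" by (auto simp: Q_eq)
  show "f + g \<in> Q k" unfolding Q_eq c d
    by (rule range_eqI[of _ _ "\<lambda>i j. c i j + d i j"]) (simp add: fun_eq_iff on_K_def bipoly_add)
qed

text \<open>The three hypotheses are the degree conditions for the yy, xy and xx derivatives, in
  this order.\<close>

lemma airy_tensor_solenoidal:
  assumes "p = 0 \<or> pderiv (pderiv q) = 0 \<or> (degree p \<le> k \<and> degree (pderiv (pderiv q)) \<le> k)"
    "pderiv p = 0 \<or> pderiv q = 0 \<or> (degree (pderiv p) \<le> k \<and> degree (pderiv q) \<le> k)"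
    "pderiv (pderiv p) = 0 \<or> q = 0 \<or> (degree (pderiv (pderiv p)) \<le> k \<and> degree q \<le> k)"
  shows "airy (tensor p q) \<in> solenoidal (Q_sym k)"
proof -
  have D: "z \<in> diamond" if "z \<in> K" for z using that K_subset_diamond by auto
  have pp: "pd 2 (pd 2 (tensor p q)) z = tensor p (pderiv (pderiv q)) z"
    "pd 1 (pd 2 (tensor p q)) z = tensor (pderiv p) (pderiv q) z"
    "pd 1 (pd 1 (tensor p q)) z = tensor (pderiv (pderiv p)) q z" if "z \<in> K" for z
    using D[OF that] by (auto simp: pd_tensor cong: pd_cong[OF open_diamond])
  have e: "(\<lambda>z. airy (tensor p q) z $ 1 $ 1) = on_K (\<lambda>z. 1 * tensor p (pderiv (pderiv q)) z)"
    "(\<lambda>z. airy (tensor p q) z $ 1 $ 2) = on_K (\<lambda>z. (-1) * tensor (pderiv p) (pderiv q) z)"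
    "(\<lambda>z. airy (tensor p q) z $ 2 $ 1) = on_K (\<lambda>z. (-1) * tensor (pderiv p) (pderiv q) z)"
    "(\<lambda>z. airy (tensor p q) z $ 2 $ 2) = on_K (\<lambda>z. 1 * tensor (pderiv (pderiv p)) q z)"
    by (auto simp: fun_eq_iff on_K_def airy_nth airy_outside pp)
  have "(\<lambda>z. airy (tensor p q) z $ i $ j) \<in> Q k" for i j
    using exhaust_2[of i] exhaust_2[of j]
    by (elim disjE; simp only: e) (intro tensor_in_Q assms)+
  moreover have "transpose (airy (tensor p q) z) = airy (tensor p q) z" for z
    by (cases "z \<in> K") (simp_all add: airy_outside airy_nth transpose_def vec2_eq_iff)
  ultimately show ?thesis
    by (simp add: solenoidal_def Q_sym_def rowdiv_airy smooth_tensor)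
qed

subsection \<open>Divergence-free polynomial stresses\<close>

text \<open>For k \<ge> 2 these are the exponents of the non-affine monomials whose Airy stress has
  all its entries in \<open>Q k\<close>.\<close>

definition airy_exponent :: "nat \<Rightarrow> nat \<Rightarrow> nat \<Rightarrow> bool"
  where "airy_exponent k i j \<longleftrightarrow> (i = 0 \<and> 2 \<le> j \<and> j \<le> k + 2) \<or> (j = 0 \<and> 2 \<le> i \<and> i \<le> k + 2) \<or>
      (i = 1 \<and> 1 \<le> j \<and> j \<le> k + 1) \<or> (j = 1 \<and> 1 \<le> i \<and> i \<le> k + 1) \<or> (2 \<le> i \<and> i \<le> k \<and> 2 \<le> j \<and> j \<le> k)"

text \<open>The potential is integrated coefficient by coefficient; the two divergence equations are
  exactly the compatibility conditions between the three entries of the stress.\<close>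

lemma solenoidal_airy:
  assumes "\<tau> \<in> solenoidal (Q_sym k)"
  shows "\<exists>p. \<tau> = airy (bipoly (k + 2) p) \<and> (\<forall>i j. p i j \<noteq> 0 \<longrightarrow> airy_exponent k i j)"
proof -
  \<comment> \<open>Two integrations raise the degree by two, so everything is written with the
    common bound \<open>k + 2\<close>.\<close>
  define n where "n = k + 2"
  have kn: "k \<le> n" by (simp add: n_def)
  have Q: "(\<lambda>z. \<tau> z $ i $ j) \<in> Q k" for i j using assms by (simp add: solenoidal_def Q_sym_def)
  have "transpose (\<tau> z) = \<tau> z" for z using assms by (simp add: solenoidal_def Q_sym_def)
  moreover have "transpose (\<tau> z) $ 2 $ 1 = \<tau> z $ 1 $ 2" for z by (simp add: transpose_def)
  ultimately have sym: "\<tau> z $ 2 $ 1 = \<tau> z $ 1 $ 2" for z by simp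
  obtain a where a: "\<And>z. z \<in> K \<Longrightarrow> \<tau> z $ 1 $ 1 = bipoly n a z" "\<And>i j. k < i \<or> k < j \<Longrightarrow> a i j = 0"
    "\<And>z. z \<notin> K \<Longrightarrow> \<tau> z $ 1 $ 1 = 0" using Q_bipolyE[OF Q kn] by metis
  obtain b where b: "\<And>z. z \<in> K \<Longrightarrow> \<tau> z $ 1 $ 2 = bipoly n b z" "\<And>i j. k < i \<or> k < j \<Longrightarrow> b i j = 0"
    "\<And>z. z \<notin> K \<Longrightarrow> \<tau> z $ 1 $ 2 = 0" using Q_bipolyE[OF Q kn] by metis
  obtain c where c: "\<And>z. z \<in> K \<Longrightarrow> \<tau> z $ 2 $ 2 = bipoly n c z" "\<And>i j. k < i \<or> k < j \<Longrightarrow> c i j = 0"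
    "\<And>z. z \<notin> K \<Longrightarrow> \<tau> z $ 2 $ 2 = 0" using Q_bipolyE[OF Q kn] by metis
  have div: "pd 1 (bipoly n a) z + pd 2 (bipoly n b) z = 0 \<and> pd 1 (bipoly n b) z + pd 2 (bipoly n c) z = 0" if z: "z \<in> K" for z
  proof -
    have "rowdiv \<tau> z = 0" using assms by (simp add: solenoidal_def)
    then have "pd 1 (\<lambda>w. \<tau> w $ 1 $ 1) z + pd 2 (\<lambda>w. \<tau> w $ 1 $ 2) z = 0"
      "pd 1 (\<lambda>w. \<tau> w $ 2 $ 1) z + pd 2 (\<lambda>w. \<tau> w $ 2 $ 2) z = 0"
      using z by (simp_all add: rowdiv_def on_K_def vec2_eq_iff sum_2)
    moreover have "pd 1 (\<lambda>w. \<tau> w $ 1 $ 1) z = pd 1 (bipoly n a) z" "pd 2 (\<lambda>w. \<tau> w $ 1 $ 2) z = pd 2 (bipoly n b) z"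
      "pd 1 (\<lambda>w. \<tau> w $ 2 $ 1) z = pd 1 (bipoly n b) z" "pd 2 (\<lambda>w. \<tau> w $ 2 $ 2) z = pd 2 (bipoly n c) z"
      by (rule pd_cong[OF open_K z], simp add: sym a b c)+
    ultimately show ?thesis by simp
  qed
  have E1: "(of_nat i + 1) * a (Suc i) j + (of_nat j + 1) * b i (Suc j) = 0" for i j
  proof (cases "i \<le> n \<and> j \<le> n")
    case True
    show ?thesis
      by (rule bipoly_zero[where n=n and i=i and j=j and c="\<lambda>i j. (of_nat i + 1) * a (Suc i) j + (of_nat j + 1) * b i (Suc j)"])
        (use True div a(2) b(2) in \<open>simp_all add: pd_bipoly bipoly_add n_def\<close>)
  qed (use a(2) b(2) n_def in auto)
  have E2: "(of_nat i + 1) * b (Suc i) j + (of_nat j + 1) * c i (Suc j) = 0" for i j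
  proof (cases "i \<le> n \<and> j \<le> n")
    case True
    show ?thesis
      by (rule bipoly_zero[where n=n and i=i and j=j and c="\<lambda>i j. (of_nat i + 1) * b (Suc i) j + (of_nat j + 1) * c i (Suc j)"])
        (use True div b(2) c(2) in \<open>simp_all add: pd_bipoly bipoly_add n_def\<close>)
  qed (use b(2) c(2) n_def in auto)
  \<comment> \<open>Mixed coefficients are integrated from the off-diagonal entry \<open>b\<close>;
    pure powers of y and of x, which \<open>b\<close> cannot see, come from \<open>a\<close> and
    \<open>c\<close>. The affine coefficients are set to 0.\<close>
  define p where "p i j = (if i = 0 then (if j < 2 then 0 else a 0 (j - 2) / (of_nat j * (of_nat j - 1)))
    else if j = 0 then (if i < 2 then 0 else c (i - 2) 0 / (of_nat i * (of_nat i - 1)))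
    else - b (i - 1) (j - 1) / (of_nat i * of_nat j))" for i j
  have pos: "real m + 2 \<noteq> 0" for m by linarith
  have cancel: "x * (y * (- u / (w * y))) = - x * u / w" if "y \<noteq> 0" for x y u w :: real
    using that by simp
  have cancel2: "x * (y * (u / (y * x))) = u" if "x \<noteq> 0" "y \<noteq> 0" for x y u :: real
    using that by simp
  have pos1: "real m + 1 \<noteq> 0" for m by linarith
  have P1: "(of_nat j + 1) * ((of_nat j + 2) * p i (Suc (Suc j))) = a i j" for i j
  proof (cases i)
    \<comment> \<open>For positive \<open>i\<close> the coefficient was defined through
      \<open>b\<close>; the first divergence equation turns it into \<open>a\<close>.\<close>
    case (Suc i')
    have "p i (Suc (Suc j)) = - b i' (Suc j) / ((of_nat i' + 1) * (of_nat j + 2))"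
      by (simp add: p_def Suc add.commute)
    then have "(of_nat j + 1) * ((of_nat j + 2) * p i (Suc (Suc j))) = - (of_nat j + 1) * b i' (Suc j) / (of_nat i' + 1)"
      by (simp only: cancel[OF pos])
    also have "\<dots> = a i j" using E1[of i' j] Suc by (simp add: field_simps)
    finally show ?thesis .
  next
    case 0
    have "p i (Suc (Suc j)) = a 0 j / ((of_nat j + 2) * (of_nat j + 1))"
      by (simp add: p_def 0 add.commute)
    then show ?thesis by (simp only: cancel2[OF pos1 pos] 0)
  qed
  have P2: "(of_nat i + 1) * ((of_nat j + 1) * p (Suc i) (Suc j)) = - b i j" for i j
  proof -
    have "p (Suc i) (Suc j) = - b i j / ((of_nat j + 1) * (of_nat i + 1))"
      by (simp add: p_def add.commute mult.commute)
    then show ?thesis by (simp only: cancel2[OF pos1 pos1])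
  qed
  have P3: "(of_nat i + 1) * ((of_nat i + 2) * p (Suc (Suc i)) j) = c i j" for i j
  proof (cases j)
    case (Suc j')
    have "p (Suc (Suc i)) j = - b (Suc i) j' / ((of_nat j' + 1) * (of_nat i + 2))"
      by (simp add: p_def Suc add.commute)
    then have "(of_nat i + 1) * ((of_nat i + 2) * p (Suc (Suc i)) j) = - (of_nat i + 1) * b (Suc i) j' / (of_nat j' + 1)"
      by (simp only: cancel[OF pos])
    also have "\<dots> = c i j" using E2[of i j'] Suc by (simp add: field_simps)
    finally show ?thesis .
  next
    case 0
    have "p (Suc (Suc i)) j = c i 0 / ((of_nat i + 2) * (of_nat i + 1))"
      by (simp add: p_def 0 add.commute)
    then show ?thesis by (simp only: cancel2[OF pos1 pos] 0)
  qed
  \<comment> \<open>Both places beyond the bound are zero, so \<open>pd_bipoly\<close> applies twice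
    with unchanged \<open>n\<close>.\<close>
  have p0: "p (Suc n) j = 0" "p (Suc (Suc n)) j = 0" "p j (Suc n) = 0" "p j (Suc (Suc n)) = 0" for j
    using a(2) b(2) c(2) by (simp_all add: p_def n_def)
  have d2: "pd 2 (bipoly n p) = bipoly n (\<lambda>i j. (of_nat j + 1) * p i (Suc j))"
    and d1: "pd 1 (bipoly n p) = bipoly n (\<lambda>i j. (of_nat i + 1) * p (Suc i) j)"
    by (simp_all add: fun_eq_iff pd_bipoly p0)
  have d22: "pd 2 (pd 2 (bipoly n p)) z = bipoly n a z" and d12: "pd 1 (pd 2 (bipoly n p)) z = - bipoly n b z"
    and d11: "pd 1 (pd 1 (bipoly n p)) z = bipoly n c z" for z
    unfolding d1 d2 bipoly_uminus by (subst pd_bipoly, simp add: p0, rule bipoly_cong, simp add: P1[symmetric] P2[symmetric] P3[symmetric])+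
  have "\<tau> = airy (bipoly n p)"
  proof
    fix z show "\<tau> z = airy (bipoly n p) z"
    proof (cases "z \<in> K")
      case True then show ?thesis by (simp add: vec2_eq_iff airy_nth sym d22 d12 d11 a b c)
    qed (simp add: vec2_eq_iff airy_outside sym a b c)
  qed
  \<comment> \<open>A nonzero coefficient shows up in each second derivative that does not kill its
    monomial, so the degree bounds on \<open>a\<close>, \<open>b\<close> and \<open>c\<close>
    restrict \<open>i\<close> and \<open>j\<close>.\<close>
  moreover have "airy_exponent k i j" if nz: "p i j \<noteq> 0" for i j
  proof -
    have "i \<le> k \<and> j - 2 \<le> k" if "j \<ge> 2"
      using P1[of "j - 2" i] a(2)[of i "j - 2"] nz that by (cases "i \<le> k \<and> j - 2 \<le> k") (auto simp: Suc_diff_Suc numeral_2_eq_2)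
    moreover have "j \<le> k \<and> i - 2 \<le> k" if "i \<ge> 2"
      using P3[of "i - 2" j] c(2)[of "i - 2" j] nz that by (cases "j \<le> k \<and> i - 2 \<le> k") (auto simp: Suc_diff_Suc numeral_2_eq_2)
    moreover have "i - 1 \<le> k \<and> j - 1 \<le> k" if "i \<ge> 1" "j \<ge> 1"
      using P2[of "i - 1" "j - 1"] b(2)[of "i - 1" "j - 1"] nz that by (cases "i - 1 \<le> k \<and> j - 1 \<le> k") auto
    moreover have "p 0 m = 0" "p m 0 = 0" if "m < 2" for m using that by (auto simp: p_def)
    then have "\<not> (i = 0 \<and> j < 2)" "\<not> (j = 0 \<and> i < 2)" using nz by auto
    ultimately show ?thesis unfolding airy_exponent_def by presburger
  qed
  ultimately show ?thesis unfolding n_def[symmetric] by blast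
qed

section \<open>Traces of divergence-free polynomial stresses\<close>

abbreviation traction :: "nat \<Rightarrow> gen_index \<Rightarrow> real^2 \<Rightarrow> real^2"
  where "traction k i \<equiv> normal_trace (airy (gen k i))"

definition fill_indices :: "nat \<Rightarrow> gen_index set"
  where "fill_indices k = {Sing2, Sing3, Sing4, SingX, Cor (k-1) 0, Cor 0 (k-1), Cor (k-1) 1, Cor 1 (k-1), ExpY, ExpX}"

text \<open>For k \<ge> 2 this leaves the monomials and the corner functions with both exponents at
  most \<open>k - 2\<close>; their tractions form a basis of the traces of solenoidal stresses in
  \<open>Q_sym k\<close>.\<close>

definition poly_indices :: "nat \<Rightarrow> gen_index set"
  where "poly_indices k = gen_indices k - fill_indices k"

lemma boundary_data_trace_eq_zero:
  assumes "boundary_data \<phi> f d" "\<And>e. e \<in> {1..4} \<Longrightarrow> degree (f e) \<le> 1 \<and> degree (d e) = 0"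
  shows "normal_trace (airy \<phi>) = 0"
proof
  fix z show "normal_trace (airy \<phi>) z = 0 z"
  proof (cases "z \<in> skeleton")
    case True
    then obtain e t where et: "e \<in> {1..4}" "t \<in> {0<..<1}" "z = edge_point e t" by (rule skeletonE)
    have "pderiv (d e) = 0" "pderiv (pderiv (f e)) = 0"
      using assms(2)[OF et(1)] by (simp_all add: pderiv_eq_0_iff degree_pderiv)
    then show ?thesis unfolding et(3) normal_trace_boundary_data[OF assms(1) et(1,2)]
      by (simp add: edge_traction_def vec2_eq_iff)
  qed (simp add: normal_trace_outside)
qed

text \<open>Such a potential has at least a double zero on each of the four edges.\<close>

lemma traction_Cor_bubble: "i \<ge> 2 \<Longrightarrow> j \<ge> 2 \<Longrightarrow> k \<ge> 2 \<Longrightarrow> traction k (Cor i j) = 0"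
  by (rule boundary_data_trace_eq_zero[OF boundary_data_gen])
    (simp_all add: tensor_val_def tensor_der_def edge_coord_def poly_corner_poly_at poly_pderiv_corner_poly power_0_left)

text \<open>After splitting off t^2, the remaining power is expanded in powers of 1 - t.\<close>

lemma corner_expansion:
  assumes "i \<ge> 2"
  obtains \<alpha> where "monom 1 i = (\<Sum>m\<le>i-2. smult (\<alpha> m) (corner_poly m))"
proof -
  let ?U = "[:1, -1:] :: real poly"
  let ?q = "pcompose (monom 1 (i-2)) ?U"
  have "degree ?q \<le> i - 2" by (simp add: degree_pcompose degree_monom_eq)
  then have q: "?q = (\<Sum>m\<le>i-2. smult (coeff ?q m) (monom 1 m))"
    using poly_as_sum_of_monoms'[of ?q "i-2"] by (simp add: smult_monom)
  have "monom (1::real) i = monom 1 2 * monom 1 (i - 2)" using assms by (simp add: mult_monom del: add_2_eq_Suc)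
  \<comment> \<open>The substitution of 1 - t for t is an involution.\<close>
  also have "monom 1 (i-2) = pcompose ?q ?U"
    by (simp add: pcompose_assoc[symmetric] pcompose_pCons)
  also have "\<dots> = (\<Sum>m\<le>i-2. smult (coeff ?q m) (pcompose (monom 1 m) ?U))"
    by (subst q) (simp only: pcompose_sum pcompose_smult)
  also have "monom 1 2 * \<dots> = (\<Sum>m\<le>i-2. smult (coeff ?q m) (corner_poly m))"
    by (simp add: sum_distrib_left corner_poly_pcompose)
  finally show ?thesis using that by blast
qed

text \<open>Expanding both factors yields corner functions with exponents at most
  \<open>k - 2\<close>; each is either in \<open>poly_indices k\<close> or a bubble with zero
  traction.\<close>

lemma traction_Mon_in_span:
  assumes k: "k \<ge> 2" and ij: "2 \<le> i" "i \<le> k" "2 \<le> j" "j \<le> k"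
  shows "traction k (Mon i j) \<in> span (traction k ` poly_indices k)"
proof -
  obtain \<alpha> where \<alpha>: "monom 1 i = (\<Sum>m\<le>i-2. smult (\<alpha> m) (corner_poly m))" using corner_expansion ij by blast
  obtain \<beta> where \<beta>: "monom 1 j = (\<Sum>m\<le>j-2. smult (\<beta> m) (corner_poly m))" using corner_expansion ij by blast
  have "gen k (Mon i j) = (\<Sum>(a,b)\<in>{..i-2} \<times> {..j-2}. (\<alpha> a * \<beta> b) *\<^sub>R gen k (Cor a b))"
    unfolding gen.simps \<alpha> \<beta>
    by (simp add: fun_eq_iff tensor_def sum_fun_apply scaleR_fun_apply poly_sum sum_product sum.cartesian_product
        case_prod_unfold mult_ac)
  also have "\<dots> = (\<Sum>ab\<in>{..i-2} \<times> {..j-2}. (\<alpha> (fst ab) * \<beta> (snd ab)) *\<^sub>R gen k (Cor (fst ab) (snd ab)))"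
    by (simp only: case_prod_unfold)
  finally have "traction k (Mon i j) = (\<Sum>ab\<in>{..i-2} \<times> {..j-2}. (\<alpha> (fst ab) * \<beta> (snd ab)) *\<^sub>R traction k (Cor (fst ab) (snd ab)))"
    by (simp only: normal_trace_airy_sum smooth_gen[OF k])
  moreover have "traction k (Cor a b) \<in> span (traction k ` poly_indices k)" if "a \<le> i-2" "b \<le> j-2" for a b
  proof (cases "a < 2 \<or> b < 2")
    case True
    then have "Cor a b \<in> poly_indices k"
      using that ij by (auto simp: poly_indices_def Cor_gen_indices[OF k] fill_indices_def)
    then show ?thesis by (intro span_base imageI)
  next
    case False then show ?thesis using traction_Cor_bubble[of a b k] k by (simp add: span_zero)
  qed
  ultimately show ?thesis by (auto intro!: span_sum span_scale)
qed

lemma subspace_Q_sym: "subspace (Q_sym k)"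
proof -
  have t: "transpose (\<sigma> + \<tau>) = transpose \<sigma> + transpose \<tau>" "transpose (c *\<^sub>R \<tau>) = c *\<^sub>R transpose \<tau>"
    "transpose (0::real^2^2) = 0" for \<sigma> \<tau> :: "real^2^2" and c :: real
    by (simp_all add: transpose_def vec2_eq_iff)
  have z: "(\<lambda>z. (0::real^2 \<Rightarrow> real^2^2) z $ i $ j) = 0" for i j by (simp add: fun_eq_iff)
  have p: "(\<lambda>z. (\<sigma> + \<tau>) z $ i $ j) = (\<lambda>z. \<sigma> z $ i $ j) + (\<lambda>z. \<tau> z $ i $ j)"
    for \<sigma> \<tau> :: "real^2 \<Rightarrow> real^2^2" and i j by (simp add: fun_eq_iff)
  have m: "(\<lambda>z. (c *\<^sub>R \<tau>) z $ i $ j) = c *\<^sub>R (\<lambda>z. \<tau> z $ i $ j)"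
    for \<tau> :: "real^2 \<Rightarrow> real^2^2" and c i j by (simp add: fun_eq_iff scaleR_fun_apply)
  show ?thesis unfolding subspace_def
  proof (intro conjI ballI allI)
    show "0 \<in> Q_sym k"
      unfolding Q_sym_def mem_Collect_eq z using subspace_0[OF subspace_Q] by (simp add: t)
    fix \<sigma> \<tau> c assume \<sigma>: "\<sigma> \<in> Q_sym k"
    then show "c *\<^sub>R \<sigma> \<in> Q_sym k"
      unfolding Q_sym_def mem_Collect_eq m using subspace_scale[OF subspace_Q] by (simp add: t scaleR_fun_apply)
    assume "\<tau> \<in> Q_sym k"
    then show "\<sigma> + \<tau> \<in> Q_sym k"
      using \<sigma> unfolding Q_sym_def mem_Collect_eq p by (simp only: plus_fun_apply t subspace_add[OF subspace_Q] simp_thms)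
  qed
qed

lemma degree_corner_poly: "degree (corner_poly m) \<le> m + 2"
proof -
  have "degree (corner_poly m) \<le> 2 + degree ([:1, -1::real:] ^ m)"
    unfolding corner_poly_def by (rule order.trans[OF degree_mult_le]) (simp add: degree_monom_eq)
  then show ?thesis using degree_power_le[of "[:1, -1::real:]" m] by simp
qed

text \<open>Removing the filling indices leaves corner functions with exponents below
  \<open>k - 1\<close>, hence of degree at most \<open>k\<close> in each variable. Monomials of
  higher degree are admissible because the offending derivatives vanish.\<close>

lemma airy_gen_solenoidal:
  assumes "k \<ge> 2" "i \<in> poly_indices k"
  shows "airy (gen k i) \<in> solenoidal (Q_sym k)"
proof (cases i)
  case (Mon a b)
  then have "(a = 0 \<and> 2 \<le> b \<and> b \<le> k + 2) \<or> (a = 1 \<and> 1 \<le> b \<and> b \<le> k + 1) \<or>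
    (b = 0 \<and> 2 \<le> a \<and> a \<le> k + 2) \<or> (b = 1 \<and> 2 \<le> a \<and> a \<le> k + 1)"
    using assms by (simp add: poly_indices_def Mon_gen_indices)
  then show ?thesis unfolding Mon gen.simps
    by (intro airy_tensor_solenoidal) (auto simp: degree_pderiv degree_monom_eq pderiv_monom)
next
  case (Cor a b)
  then have "a < k - 1" "b < k - 1"
    using assms by (auto simp: poly_indices_def Cor_gen_indices fill_indices_def less_2_cases_iff)
  moreover have "degree (corner_poly m) \<le> k" if "m < k - 1" for m
    using degree_corner_poly[of m] that by simp
  ultimately have "degree (corner_poly a) \<le> k" "degree (corner_poly b) \<le> k" by auto
  then show ?thesis unfolding Cor gen.simps
    by (intro airy_tensor_solenoidal) (auto simp: degree_pderiv)
qed (use assms in \<open>auto simp: poly_indices_def fill_indices_def\<close>)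

lemma bipoly_eq_sum_gen:
  "bipoly n p = (\<Sum>ij\<in>{..n} \<times> {..n}. p (fst ij) (snd ij) *\<^sub>R gen k (Mon (fst ij) (snd ij)))"
  by (simp add: fun_eq_iff bipoly_def tensor_def sum_fun_apply scaleR_fun_apply poly_monom sum.cartesian_product
      case_prod_unfold mult_ac)

lemma solenoidal_traces:
  assumes k: "k \<ge> 2"
  shows "normal_trace ` solenoidal (Q_sym k) = span (traction k ` poly_indices k)"
proof
  show "normal_trace ` solenoidal (Q_sym k) \<subseteq> span (traction k ` poly_indices k)"
  proof clarify
    fix \<tau> assume "\<tau> \<in> solenoidal (Q_sym k)"
    then obtain p where p: "\<tau> = airy (bipoly (k + 2) p)"
      "\<And>i j. p i j \<noteq> 0 \<Longrightarrow> airy_exponent k i j"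
      using solenoidal_airy by blast
    have "bipoly (k + 2) p = (\<Sum>ij\<in>{..k+2} \<times> {..k+2}. p (fst ij) (snd ij) *\<^sub>R gen k (Mon (fst ij) (snd ij)))"
      by (rule bipoly_eq_sum_gen)
    then have "normal_trace \<tau> = (\<Sum>ij\<in>{..k+2} \<times> {..k+2}. p (fst ij) (snd ij) *\<^sub>R traction k (Mon (fst ij) (snd ij)))"
      unfolding p(1) by (simp only: normal_trace_airy_sum smooth_gen[OF k])
    moreover have "p i j *\<^sub>R traction k (Mon i j) \<in> span (traction k ` poly_indices k)" for i j
    proof (cases "p i j = 0")
      case False
      \<comment> \<open>An admissible exponent is either at most 1 in some variable, hence an index,
        or lies between 2 and \<open>k\<close> in both and is expanded into corner
        functions.\<close>
      from p(2)[OF this] have "Mon i j \<in> gen_indices k \<or> (2 \<le> i \<and> i \<le> k \<and> 2 \<le> j \<and> j \<le> k)"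
        unfolding Mon_gen_indices airy_exponent_def by presburger
      then show ?thesis
      proof
        assume "Mon i j \<in> gen_indices k"
        then have "Mon i j \<in> poly_indices k" by (simp add: poly_indices_def fill_indices_def)
        then show ?thesis by (intro span_scale span_base imageI)
      qed (use traction_Mon_in_span[OF k] in \<open>auto intro: span_scale\<close>)
    qed (simp add: span_zero)
    ultimately show "normal_trace \<tau> \<in> span (traction k ` poly_indices k)"
      by (auto intro!: span_sum)
  qed
  let ?S = "span (gen k ` poly_indices k)"
  have sm: "smooth f" if "f \<in> ?S" for f
    using span_minimal[OF _ subspace_smooth, of "gen k ` poly_indices k"] that smooth_gen[OF k] by auto
  have "airy ` ?S = span (airy ` gen k ` poly_indices k)" using smooth_gen[OF k] by (intro airy_span) auto
  also have "\<dots> \<subseteq> Q_sym k"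
    using airy_gen_solenoidal[OF k] by (intro span_minimal subspace_Q_sym) (auto simp: solenoidal_def)
  finally have "airy ` ?S \<subseteq> solenoidal (Q_sym k)" using sm by (auto simp: solenoidal_def rowdiv_airy)
  moreover have "normal_trace ` airy ` ?S = span (traction k ` poly_indices k)"
    using normal_trace_airy_span[of "gen k ` poly_indices k"] smooth_gen[OF k] by (auto simp: image_image)
  ultimately show "span (traction k ` poly_indices k) \<subseteq> normal_trace ` solenoidal (Q_sym k)"
    by (metis image_mono)
qed

subsection \<open>Polynomial traces on the boundary and rigid motions\<close>

text \<open>The basis behind the dimension of \<open>P_bd k\<close>: four edges, two components, and
  k + 1 powers of the edge coordinate.\<close>

definition edge_monomial :: "nat \<times> 2 \<times> nat \<Rightarrow> real^2 \<Rightarrow> real^2"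
  where "edge_monomial = (\<lambda>(e, m, n) z. if z \<in> edge e then (z $ tangent e)^n *\<^sub>R axis m 1 else 0)"

lemma edge_point_tangent: "e \<in> {1..4} \<Longrightarrow> edge_point e t $ tangent e = t"
  by (erule edge_cases) (simp_all add: edge_point_def tangent_def)

lemma edge_monomial_sum:
  assumes e: "e \<in> {1..4}" and t: "t \<in> {0<..<1}"
  shows "(\<Sum>x\<in>{1..4} \<times> UNIV \<times> {..k}. c x *\<^sub>R edge_monomial x) (edge_point e t) $ m = (\<Sum>n\<le>k. c (e, m, n) * t^n)"
proof -
  have "(\<Sum>x\<in>{1..4} \<times> UNIV \<times> {..k}. c x *\<^sub>R edge_monomial x) (edge_point e t) $ m =
    (\<Sum>e'\<in>{1..4}. \<Sum>m'\<in>UNIV. \<Sum>n\<le>k. c (e', m', n) * edge_monomial (e', m', n) (edge_point e t) $ m)"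
    by (simp add: sum_fun_apply scaleR_fun_apply sum.cartesian_product')
  also have "\<dots> = (\<Sum>e'\<in>{1..4}. if e' = e then \<Sum>m'\<in>UNIV. if m' = m then \<Sum>n\<le>k. c (e, m, n) * t^n else 0 else 0)"
  proof (intro sum.cong refl)
    fix e' assume e': "e' \<in> {1..4::nat}"
    show "(\<Sum>m'\<in>UNIV. \<Sum>n\<le>k. c (e', m', n) * edge_monomial (e', m', n) (edge_point e t) $ m) =
      (if e' = e then \<Sum>m'\<in>UNIV. if m' = m then \<Sum>n\<le>k. c (e, m, n) * t^n else 0 else 0)"
      using edge_point_mem_edge[OF e e' t] edge_point_tangent[OF e] exhaust_2[of m]
      by (auto simp: edge_monomial_def axis_def sum_2)
  qed
  also have "\<dots> = (\<Sum>n\<le>k. c (e, m, n) * t^n)" using e by simp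
  finally show ?thesis .
qed

lemma P_bd_eq_span: "P_bd k = span (edge_monomial ` ({1..4} \<times> UNIV \<times> {..k}))"
proof -
  let ?I = "{1..4::nat} \<times> (UNIV :: 2 set) \<times> {..k}"
  have tangent: "z $ tangent e = (if odd e then z$2 else z$1)" for z :: "real^2" and e
    by (simp add: tangent_def)
  have "g \<in> range (\<lambda>c. \<Sum>x\<in>?I. c x *\<^sub>R edge_monomial x)" if g: "g \<in> P_bd k" for g
  proof -
    have "\<forall>e\<in>{1..4}. \<forall>m. \<exists>p :: real poly. degree p \<le> k \<and> (\<forall>z\<in>edge e. g z $ m = poly p (z $ tangent e))"
      using g unfolding P_bd_def tangent by blast
    then obtain p where p: "\<And>e m. e \<in> {1..4} \<Longrightarrow> degree (p e m) \<le> k \<and> (\<forall>z\<in>edge e. g z $ m = poly (p e m) (z $ tangent e))"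
      by metis
    have "g = (\<Sum>x\<in>?I. coeff (p (fst x) (fst (snd x))) (snd (snd x)) *\<^sub>R edge_monomial x)"
    proof
      fix z show "g z = (\<Sum>x\<in>?I. coeff (p (fst x) (fst (snd x))) (snd (snd x)) *\<^sub>R edge_monomial x) z"
      proof (cases "z \<in> skeleton")
        case True
        then obtain e t where et: "e \<in> {1..4}" "t \<in> {0<..<1}" "z = edge_point e t" by (rule skeletonE)
        have "poly (p e m) t = (\<Sum>n\<le>k. coeff (p e m) n * t^n)" for m
          unfolding poly_altdef using p[OF et(1), of m]
          by (intro sum.mono_neutral_left) (auto intro: coeff_eq_0)
        moreover have "g z $ m = poly (p e m) t" for m
          using p[OF et(1), of m] et edge_point_mem_edge[OF et(1) et(1) et(2)] edge_point_tangent[OF et(1)] by auto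
        ultimately show ?thesis
          unfolding vec_eq_iff et(3) edge_monomial_sum[OF et(1,2)] by simp
      next
        case False
        then have "z \<notin> edge e" if "e \<in> {1..4}" for e using that by (auto simp: skeleton_def)
        then have "edge_monomial x z = 0" if "x \<in> ?I" for x using that by (auto simp: edge_monomial_def)
        then have "(\<Sum>x\<in>?I. coeff (p (fst x) (fst (snd x))) (snd (snd x)) *\<^sub>R edge_monomial x) z = 0"
          by (simp add: sum_fun_apply scaleR_fun_apply del: mem_Sigma_iff)
        moreover have "g z = 0" using g False by (simp add: P_bd_def)
        ultimately show ?thesis by simp
      qed
    qed
    then show ?thesis by (rule range_eqI[of _ _ "\<lambda>x. coeff (p (fst x) (fst (snd x))) (snd (snd x))"])
  qed
  moreover have "(\<Sum>x\<in>?I. c x *\<^sub>R edge_monomial x) \<in> P_bd k" for c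
    unfolding P_bd_def mem_Collect_eq
  proof (intro conjI allI impI ballI)
    fix z assume "z \<notin> skeleton"
    then have "z \<notin> edge e" if "e \<in> {1..4}" for e using that by (auto simp: skeleton_def)
    then have "edge_monomial x z = 0" if "x \<in> ?I" for x using that by (auto simp: edge_monomial_def)
    then show "(\<Sum>x\<in>?I. c x *\<^sub>R edge_monomial x) z = 0"
      by (simp add: sum_fun_apply scaleR_fun_apply del: mem_Sigma_iff)
  next
    fix e :: nat and m :: 2 assume e: "e \<in> {1..4}"
    let ?p = "\<Sum>n\<le>k. monom (c (e, m, n)) n"
    have "degree ?p \<le> k"
      by (intro degree_sum_le) (auto intro: order.trans[OF degree_monom_le])
    moreover have "(\<Sum>x\<in>?I. c x *\<^sub>R edge_monomial x) z $ m = poly ?p (if odd e then z$2 else z$1)" if "z \<in> edge e" for z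
    proof -
      obtain t where t: "t \<in> {0<..<1}" "z = edge_point e t" using \<open>z \<in> edge e\<close> edge_eq[OF e] by auto
      have "(if odd e then z$2 else z$1) = t" using edge_point_tangent[OF e, of t] t(2) by (auto simp: tangent_def)
      then show ?thesis unfolding t(2) edge_monomial_sum[OF e t(1)] by (simp add: poly_sum poly_monom)
    qed
    ultimately show "\<exists>p. degree p \<le> k \<and> (\<forall>z\<in>edge e. (\<Sum>x\<in>?I. c x *\<^sub>R edge_monomial x) z $ m =
      poly p (if odd e then z$2 else z$1))" by blast
  qed
  ultimately have "P_bd k = range (\<lambda>c. \<Sum>x\<in>?I. c x *\<^sub>R edge_monomial x)" by blast
  then show ?thesis by (simp only: span_family finite_cartesian_product finite finite_atMost finite_atLeastAtMost)
qed

lemma dim_P_bd: "dim (P_bd k) = 8 * (k + 1)"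
proof -
  let ?I = "{1..4::nat} \<times> (UNIV :: 2 set) \<times> {..k}"
  have "lin_indep edge_monomial ?I"
    unfolding lin_indep_def
  proof (intro allI impI ballI)
    fix c x assume z: "(\<Sum>x\<in>?I. c x *\<^sub>R edge_monomial x) = 0" and "x \<in> ?I"
    then obtain e m n where x: "x = (e, m, n)" "e \<in> {1..4}" "n \<le> k" by auto
    have "(\<Sum>n\<le>k. c (e, m, n) * t^n) = 0" if "t \<in> {0<..<1}" for t
      using edge_monomial_sum[OF x(2) that, where k=k and c=c and m=m] unfolding z by simp
    then show "c x = 0" unfolding x(1) by (rule power_sum_zero_on_interval[where a="\<lambda>n. c (e, m, n)"]) (simp_all add: x(3))
  qed
  then have "dim (edge_monomial ` ?I) = card ?I" by (rule dim_lin_indep) simp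
  then show ?thesis by (simp add: P_bd_eq_span card_cartesian_product)
qed

section \<open>Rigid motions and their traces\<close>

definition rigid :: "real \<Rightarrow> real \<Rightarrow> real \<Rightarrow> real^2 \<Rightarrow> real^2"
  where "rigid a b c z = vector [a + c * z$2, b - c * z$1]"

text \<open>Comparing coefficients, the diagonal strains leave a first component depending on y only
  and a second depending on x only; the shear equation makes both affine with opposite slopes. The
  bound on \<open>k\<close> puts these linear fields into \<open>Q_vec k\<close>.\<close>

lemma rigid_motions:
  assumes k: "k \<ge> 1"
  shows "{v \<in> Q_vec k. symgrad v = 0} = range (\<lambda>(a, b, c). on_K (rigid a b c))"
proof (intro equalityI subsetI)
  fix v assume "v \<in> {v \<in> Q_vec k. symgrad v = 0}"
  then have Q: "(\<lambda>z. v z $ i) \<in> Q k" and s: "symgrad v = 0" for i by (simp_all add: Q_vec_def)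
  obtain a where a: "\<And>z. z \<in> K \<Longrightarrow> v z $ 1 = bipoly k a z" "\<And>i j. k < i \<or> k < j \<Longrightarrow> a i j = 0"
    "\<And>z. z \<notin> K \<Longrightarrow> v z $ 1 = 0" using Q_bipolyE[OF Q order_refl] by metis
  obtain b where b: "\<And>z. z \<in> K \<Longrightarrow> v z $ 2 = bipoly k b z" "\<And>i j. k < i \<or> k < j \<Longrightarrow> b i j = 0"
    "\<And>z. z \<notin> K \<Longrightarrow> v z $ 2 = 0" using Q_bipolyE[OF Q order_refl] by metis
  have s0: "pd 1 (bipoly k a) z = 0 \<and> pd 2 (bipoly k b) z = 0 \<and> pd 2 (bipoly k a) z + pd 1 (bipoly k b) z = 0"
    if z: "z \<in> K" for z
  proof -
    have "symgrad v z $ i $ j = 0" for i j using s by simp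
    from this[of 1 1] this[of 2 2] this[of 1 2]
    have "pd 1 (\<lambda>w. v w $ 1) z = 0" "pd 2 (\<lambda>w. v w $ 2) z = 0" "pd 2 (\<lambda>w. v w $ 1) z + pd 1 (\<lambda>w. v w $ 2) z = 0"
      using z by (simp_all add: symgrad_def on_K_def)
    moreover have "pd i (\<lambda>w. v w $ 1) z = pd i (bipoly k a) z" "pd i (\<lambda>w. v w $ 2) z = pd i (bipoly k b) z" for i
      by (rule pd_cong[OF open_K z], simp add: a b)+
    ultimately show ?thesis by simp
  qed
  have A: "a (Suc i) j = 0" for i j
  proof (cases "i \<le> k \<and> j \<le> k")
    case True
    have "(of_nat i + 1) * a (Suc i) j = 0"
      by (rule bipoly_zero[where n=k and i=i and j=j and c="\<lambda>i j. (of_nat i + 1) * a (Suc i) j"])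
        (use True s0 a(2) in \<open>simp_all add: pd_bipoly\<close>)
    then show ?thesis by (metis mult_eq_0_iff of_nat_Suc of_nat_eq_0_iff add.commute Zero_not_Suc)
  qed (use a(2) in auto)
  have B: "b i (Suc j) = 0" for i j
  proof (cases "i \<le> k \<and> j \<le> k")
    case True
    have "(of_nat j + 1) * b i (Suc j) = 0"
      by (rule bipoly_zero[where n=k and i=i and j=j and c="\<lambda>i j. (of_nat j + 1) * b i (Suc j)"])
        (use True s0 b(2) in \<open>simp_all add: pd_bipoly\<close>)
    then show ?thesis by (metis mult_eq_0_iff of_nat_Suc of_nat_eq_0_iff add.commute Zero_not_Suc)
  qed (use b(2) in auto)
  have A': "a i j = 0" if "i \<noteq> 0" for i j using that A by (cases i) auto
  have B': "b i j = 0" if "j \<noteq> 0" for i j using that B by (cases j) auto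
  have C: "(of_nat j + 1) * a i (Suc j) + (of_nat i + 1) * b (Suc i) j = 0" for i j
  proof (cases "i \<le> k \<and> j \<le> k")
    case True
    show ?thesis
      by (rule bipoly_zero[where n=k and i=i and j=j and c="\<lambda>i j. (of_nat j + 1) * a i (Suc j) + (of_nat i + 1) * b (Suc i) j"])
        (use True s0 a(2) b(2) in \<open>simp_all add: pd_bipoly bipoly_add\<close>)
  qed (use a(2) b(2) in auto)
  \<comment> \<open>For j \<ge> 2 the shear equation ties \<open>a 0 j\<close> to a coefficient of
    \<open>b\<close> with positive y-degree, which is zero.\<close>
  have a0: "a i j = (if i = 0 then if j = 0 then a 0 0 else if j = 1 then a 0 1 else 0 else 0)" for i j
  proof (cases "i = 0 \<and> j \<ge> 2")
    case True
    then obtain j' where "j = Suc (Suc j')" by (metis add_2_eq_Suc le_Suc_ex)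
    then show ?thesis using C[of "Suc j'" 0] B True by (simp add: add_eq_0_iff)
  next
    case False then show ?thesis using A[of "i - 1" j] by (cases i) (auto simp: less_2_cases_iff not_le)
  qed
  have b0: "b i j = (if j = 0 then if i = 0 then b 0 0 else if i = 1 then - a 0 1 else 0 else 0)" for i j
  proof (cases "j = 0 \<and> i \<ge> 2")
    case True
    then obtain i' where "i = Suc (Suc i')" by (metis add_2_eq_Suc le_Suc_ex)
    then show ?thesis using C[of 0 "Suc i'"] A True by (simp add: add_eq_0_iff)
  next
    case False then show ?thesis using B[of i "j - 1"] C[of 0 0] by (cases j) (auto simp: less_2_cases_iff not_le)
  qed
  have "bipoly k a z = a 0 0 + a 0 1 * z$2" for z
  proof -
    have "bipoly k a z = (\<Sum>i\<le>k. if i = 0 then (\<Sum>j\<le>k. a 0 j * (z$2)^j) else 0)"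
      unfolding bipoly_def by (intro sum.cong refl) (simp add: A')
    also have "\<dots> = (\<Sum>j\<le>k. a 0 j * (z$2)^j)" by simp
    also have "\<dots> = (\<Sum>j\<in>{0,1}. a 0 j * (z$2)^j)"
      by (rule sum.mono_neutral_right) (use k a0 in auto)
    finally show ?thesis by simp
  qed
  moreover have "bipoly k b z = b 0 0 - a 0 1 * z$1" for z
  proof -
    have "bipoly k b z = (\<Sum>i\<le>k. \<Sum>j\<le>k. if j = 0 then b i 0 * (z$1)^i else 0)"
      unfolding bipoly_def by (intro sum.cong refl) (simp add: B')
    also have "\<dots> = (\<Sum>i\<le>k. b i 0 * (z$1)^i)" by simp
    also have "\<dots> = (\<Sum>i\<in>{0,1}. b i 0 * (z$1)^i)"
      by (rule sum.mono_neutral_right) (use k b0 in auto)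
    also have "\<dots> = b 0 0 + b 1 0 * z$1" by simp
    also have "b 1 0 = - a 0 1" by (subst b0) simp
    finally show ?thesis by simp
  qed
  ultimately have "v = on_K (rigid (a 0 0) (b 0 0) (a 0 1))"
    using a(1,3) b(1,3) by (auto simp: fun_eq_iff vec2_eq_iff on_K_def rigid_def)
  then show "v \<in> range (\<lambda>(a, b, c). on_K (rigid a b c))" by (intro range_eqI[of _ _ "(a 0 0, b 0 0, a 0 1)"]) simp
next
  fix v assume "v \<in> range (\<lambda>(a, b, c). on_K (rigid a b c))"
  then obtain a b c where v: "v = on_K (rigid a b c)" by auto
  have e: "(\<lambda>z. v z $ 1) = on_K (\<lambda>z. 1 * tensor [:1:] [:a, c:] z)" "(\<lambda>z. v z $ 2) = on_K (\<lambda>z. 1 * tensor [:b, -c:] [:1:] z)"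
    by (auto simp: v fun_eq_iff on_K_def rigid_def tensor_def)
  have "(\<lambda>z. v z $ 1) \<in> Q k" "(\<lambda>z. v z $ 2) \<in> Q k" unfolding e using k by (intro tensor_in_Q; auto)+
  then have "v \<in> Q_vec k" by (simp add: Q_vec_def forall_2)
  moreover have "symgrad v z = 0" for z
  proof (cases "z \<in> K")
    case True
    then have zd: "z \<in> diamond" using K_subset_diamond by auto
    have "pd i (\<lambda>w. v w $ 1) z = pd i (tensor [:1:] [:a, c:]) z" "pd i (\<lambda>w. v w $ 2) z = pd i (tensor [:b, -c:] [:1:]) z" for i
      by (rule pd_cong[OF open_K True], simp add: v on_K_def rigid_def tensor_def)+
    then show ?thesis using True
      by (simp add: symgrad_def on_K_def vec2_eq_iff pd_tensor[OF zd] pderiv_pCons) (simp add: tensor_def)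
  qed (simp add: symgrad_def on_K_def)
  ultimately show "v \<in> {v \<in> Q_vec k. symgrad v = 0}" by (simp add: fun_eq_iff)
qed

lemma trace_rigid: "trace_bd (on_K (rigid a b c)) = (\<lambda>z. if z \<in> skeleton then rigid a b c z else 0)"
proof
  fix z show "trace_bd (on_K (rigid a b c)) z = (if z \<in> skeleton then rigid a b c z else 0)"
  proof (cases "z \<in> skeleton")
    case True
    have "((\<lambda>w. rigid a b c w $ i) \<longlongrightarrow> rigid a b c z $ i) (at z)" for i
      using exhaust_2[of i] by (elim disjE; simp add: rigid_def; intro tendsto_intros)
    then have "isCont (rigid a b c) z" unfolding isCont_def by (rule vec_tendstoI)
    then show ?thesis using True by (simp add: trace_bd_eqI on_K_def)
  qed (simp add: trace_bd_def)
qed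

lemma dim_rigid_traces:
  assumes "k \<ge> 1"
  shows "dim (trace_bd ` {v \<in> Q_vec k. symgrad v = 0}) = 3"
proof -
  define r :: "nat \<Rightarrow> real^2 \<Rightarrow> real^2" where
    "r i z = (if z \<in> skeleton then rigid (of_bool (i = 0)) (of_bool (i = 1)) (of_bool (i = 2)) z else 0)" for i z
  have sum: "(\<Sum>i<3. c i *\<^sub>R r i) = (\<lambda>z. if z \<in> skeleton then rigid (c 0) (c 1) (c 2) z else 0)" for c
  proof
    have three: "{..<3::nat} = {0, 1, 2}" by auto
    fix z show "(\<Sum>i<3. c i *\<^sub>R r i) z = (if z \<in> skeleton then rigid (c 0) (c 1) (c 2) z else 0)"
      by (cases "z \<in> skeleton")
        (simp_all add: three sum_fun_apply scaleR_fun_apply r_def rigid_def vec2_eq_iff algebra_simps)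
  qed
  have "trace_bd ` {v \<in> Q_vec k. symgrad v = 0} = range (\<lambda>c. \<Sum>i<3. c i *\<^sub>R r i)"
    unfolding rigid_motions[OF assms] sum image_image
  proof (intro equalityI subsetI)
    fix g assume "g \<in> range (\<lambda>x. trace_bd (case x of (a, b, c) \<Rightarrow> on_K (rigid a b c)))"
    then obtain a b c where "g = (\<lambda>z. if z \<in> skeleton then rigid a b c z else 0)" by (auto simp: trace_rigid)
    then show "g \<in> range (\<lambda>c z. if z \<in> skeleton then rigid (c 0) (c 1) (c (2::nat)) z else 0)"
      by (intro range_eqI[of _ _ "\<lambda>i. if i = 0 then a else if i = (1::nat) then b else c"]) simp
  next
    fix g assume "g \<in> range (\<lambda>c z. if z \<in> skeleton then rigid (c 0) (c 1) (c (2::nat)) z else 0)"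
    then obtain c where "g = (\<lambda>z. if z \<in> skeleton then rigid (c 0) (c 1) (c (2::nat)) z else 0)" ..
    then have "g = trace_bd (on_K (rigid (c 0) (c 1) (c 2)))" by (simp only: trace_rigid)
    then show "g \<in> range (\<lambda>x. trace_bd (case x of (a, b, c) \<Rightarrow> on_K (rigid a b c)))"
      by (intro range_eqI[of _ _ "(c 0, c 1, c 2)"]) simp
  qed
  then have "trace_bd ` {v \<in> Q_vec k. symgrad v = 0} = span (r ` {..<3})" by (simp only: span_family finite_lessThan)
  moreover have "lin_indep r {..<3}"
    unfolding lin_indep_def
  proof (intro allI impI ballI)
    fix c and i :: nat assume c: "(\<Sum>i<3. c i *\<^sub>R r i) = 0" and i: "i \<in> {..<3}"
    have "rigid (c 0) (c 1) (c 2) z = 0" if "z \<in> skeleton" for z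
      using fun_cong[OF sum[of c], of z] that by (simp only: c zero_fun_apply if_True)
    \<comment> \<open>The midpoints of the edges x = 0 and y = 0 already determine all three
      parameters.\<close>
    from this[OF edge_point_skeleton, of 1 "1/2"] this[OF edge_point_skeleton, of 2 "1/2"]
    have "c 0 = 0 \<and> c 1 = 0 \<and> c 2 = 0" by (simp add: rigid_def edge_point_def vec2_eq_iff)
    moreover have "i = 0 \<or> i = 1 \<or> i = 2" using i by auto
    ultimately show "c i = 0" by auto
  qed
  ultimately show ?thesis using dim_lin_indep[of r "{..<3}"] by simp
qed

subsection \<open>The filling space\<close>

text \<open>An exponent 0 stands for an absent factor. For k = 2 the indices
  \<open>Cor (k-1) 1\<close> and \<open>Cor 1 (k-1)\<close> coincide, which accounts for the shorter
  list.\<close>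

lemma fill_generators_eq: assumes "k \<ge> 2" shows "fill_generators k = gen k ` fill_indices k"
proof -
  have c: "gen k (Cor i j) = (\<lambda>z. (z$1 * z$2)^2 * (1 - z$1)^i * (1 - z$2)^j)" for i j
    by (simp add: fun_eq_iff tensor_def poly_corner_poly power_mult_distrib mult_ac)
  show ?thesis
    unfolding fill_generators_def fill_indices_def image_insert image_empty c
    by (cases "k = 2") (simp_all add: insert_commute)
qed

lemma fill_indices_subset: "k \<ge> 2 \<Longrightarrow> fill_indices k \<subseteq> gen_indices k"
  by (auto simp: fill_indices_def Cor_gen_indices) (auto simp: gen_indices_def)

lemma normal_trace_in_P_bd:
  assumes bd: "boundary_data \<phi> f d" and deg: "\<And>e. degree (f e) \<le> k + 2 \<and> degree (d e) \<le> k + 1"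
  shows "normal_trace (airy \<phi>) \<in> P_bd k"
  unfolding P_bd_def mem_Collect_eq
proof (intro conjI allI impI ballI normal_trace_outside)
  fix e :: nat and m :: 2 assume e: "e \<in> {1..4}"
  let ?p = "smult (edge_sign e) (if m = normal e then pderiv (pderiv (f e)) else - pderiv (d e))"
  have "degree ?p \<le> k"
    using deg[of e] by (intro order.trans[OF degree_smult_le]) (auto simp: degree_pderiv)
  moreover have "normal_trace (airy \<phi>) z $ m = poly ?p (if odd e then z$2 else z$1)" if "z \<in> edge e" for z
  proof -
    obtain t where t: "t \<in> {0<..<1}" "z = edge_point e t" using \<open>z \<in> edge e\<close> edge_eq[OF e] by auto
    have "(if odd e then z$2 else z$1) = t" using edge_point_tangent[OF e, of t] t(2) by (auto simp: tangent_def)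
    then show ?thesis unfolding t(2) normal_trace_boundary_data[OF bd e t(1)]
      using exhaust_2[of m] by (auto simp: edge_traction_def normal_def)
  qed
  ultimately show "\<exists>p. degree p \<le> k \<and> (\<forall>z\<in>edge e. normal_trace (airy \<phi>) z $ m = poly p (if odd e then z$2 else z$1))"
    by blast
qed

text \<open>The bound k + 2 for values is attained by the exponential generators, whose datum is
  \<open>corner_poly k\<close>. Corner functions have exponents at most \<open>k - 1\<close>, as the
  bound k + 1 for normal derivatives demands; the cubic datum of \<open>SingX\<close> fits since k
  \<ge> 2.\<close>

lemma fill_traction_in_P_bd:
  assumes k: "k \<ge> 2" and i: "i \<in> fill_indices k"
  shows "traction k i \<in> P_bd k"
proof (rule normal_trace_in_P_bd[OF boundary_data_gen[OF k]])
  fix e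
  have c: "degree (corner_poly m) \<le> k + 2" if "m \<le> k" for m using degree_corner_poly[of m] that by simp
  have c': "degree (corner_poly m) \<le> k + 1" if "m \<le> k - 1" for m using degree_corner_poly[of m] that k by simp
  have "degree (gen_val k (Cor a b) e) \<le> k + 2 \<and> degree (gen_der k (Cor a b) e) \<le> k + 1" if "a \<le> k - 1" "b \<le> k - 1" for a b
    using c[of a] c[of b] c'[of a] c'[of b] that
    by (auto simp: tensor_val_def tensor_der_def intro: order.trans[OF degree_smult_le])
  then show "degree (gen_val k i e) \<le> k + 2 \<and> degree (gen_der k i e) \<le> k + 1"
    using i k c[of k] c'[of 1] unfolding fill_indices_def by (auto simp del: gen_val.simps(2) gen_der.simps(2))
qed

theorem theorem4p2:
  fixes k :: nat
  assumes "k \<ge> 2"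
  shows "rowdiv ` fillM k = {0}
    \<and> normal_trace ` fillM k \<subseteq> P_bd k
    \<and> normal_trace ` fillM k \<inter> normal_trace ` solenoidal (Q_sym k) = {0}
    \<and> dim (fillM k) = dim (normal_trace ` fillM k)
    \<and> int (dim (normal_trace ` fillM k)) = I_M (P_bd k) (Q_sym k) (Q_vec k)"
proof -
  note k = assms
  let ?F = "fill_indices k" and ?P = "poly_indices k"
  have sub: "?F \<subseteq> gen_indices k" "?P \<subseteq> gen_indices k" and un: "?F \<union> ?P = gen_indices k" and int: "?F \<inter> ?P = {}"
    using fill_indices_subset[OF k] by (auto simp: poly_indices_def)
  have fin: "finite ?F" "finite ?P" using sub finite_gen_indices finite_subset by blast+
  have ind: "lin_indep (traction k) ?F" "lin_indep (traction k) ?P"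
    using lin_indep_subset[OF lin_indep_traces[OF k] _ finite_gen_indices] sub by auto
  have sm: "smooth f" if "f \<in> gen k ` ?F" for f using that smooth_gen[OF k] by auto
  have sm_span: "smooth f" if "f \<in> span (gen k ` ?F)" for f
    using span_minimal[OF _ subspace_smooth, of "gen k ` ?F"] sm that by auto
  have fill: "fillM k = span ((\<lambda>i. airy (gen k i)) ` ?F)"
    unfolding fillM_def fill_generators_eq[OF k] by (subst airy_span) (simp_all only: sm image_image)
  have trace_fill: "normal_trace ` fillM k = span (traction k ` ?F)"
    unfolding fillM_def fill_generators_eq[OF k] by (subst normal_trace_airy_span) (simp_all only: sm image_image)
  \<comment> \<open>Independence of the stresses is inherited from their tractions: the normal trace
    carries a relation between the former to one between the latter.\<close>
  have "lin_indep (\<lambda>i. airy (gen k i)) ?F"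
    unfolding lin_indep_def
  proof (intro allI impI)
    fix c assume "(\<Sum>i\<in>?F. c i *\<^sub>R airy (gen k i)) = 0"
    then have "airy (\<Sum>i\<in>?F. c i *\<^sub>R gen k i) = airy 0"
      using airy_scaleR[OF smooth_const, of 0 0] by (simp add: airy_sum smooth_gen[OF k])
    moreover have "normal_trace (airy 0) = 0"
      using normal_trace_airy_scaleR[OF smooth_const, of 0 0] by simp
    ultimately have "(\<Sum>i\<in>?F. c i *\<^sub>R traction k i) = 0"
      using normal_trace_airy_sum[of ?F "gen k" c] smooth_gen[OF k] by simp
    then show "\<forall>i\<in>?F. c i = 0" using ind(1) by (simp add: lin_indep_def)
  qed
  then have d1: "dim (fillM k) = card ?F" unfolding fill dim_span using fin(1) by (rule dim_lin_indep)
  have d2: "dim (normal_trace ` fillM k) = card ?F"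
    unfolding trace_fill dim_span using ind(1) fin(1) by (rule dim_lin_indep)
  have d3: "dim (normal_trace ` solenoidal (Q_sym k)) = card ?P"
    unfolding solenoidal_traces[OF k] dim_span using ind(2) fin(2) by (rule dim_lin_indep)
  \<comment> \<open>\<open>?P\<close> counts the subtracted trace dimension, so
    \<open>card ?F\<close> is what remains of 8 (k + 1) - 3.\<close>
  have "card ?F + card ?P = 8 * k + 5"
    using card_Un_disjoint[OF fin int] card_gen_indices[OF k] un by simp
  then have "int (card ?F) = I_M (P_bd k) (Q_sym k) (Q_vec k)"
    using k by (simp add: I_M_def d3 dim_P_bd dim_rigid_traces)
  moreover have "rowdiv ` fillM k = {0}"
  proof -
    have "rowdiv (airy f) = 0" if "f \<in> span (gen k ` ?F)" for f using sm_span[OF that] by (rule rowdiv_airy)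
    then have "(\<lambda>f. rowdiv (airy f)) ` span (gen k ` ?F) = (\<lambda>f. 0) ` span (gen k ` ?F)"
      by (intro image_cong refl)
    also have "\<dots> = {0}" using span_zero by (rule image_constant)
    finally show ?thesis unfolding fillM_def fill_generators_eq[OF k] image_image .
  qed
  moreover have "normal_trace ` fillM k \<subseteq> P_bd k"
    unfolding trace_fill using fill_traction_in_P_bd[OF k]
    by (intro span_minimal) (auto simp: P_bd_eq_span)
  \<comment> \<open>The two trace spaces are spanned by complementary parts of one independent
    family.\<close>
  moreover have "normal_trace ` fillM k \<inter> normal_trace ` solenoidal (Q_sym k) = {0}"
    unfolding trace_fill solenoidal_traces[OF k]
    using lin_indep_traces[OF k] by (intro lin_indep_span_disjoint fin int) (simp add: un)
  ultimately show ?thesis using d1 d2 by simp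
qed

end
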